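(* For each $m\ge 1$ let $X_1,\dots,X_m$ be i.i.d. observations from the two-groups mixture $(1-p)N(0,1)+pN(0,1+\psi^2)$ with latent indicators $\nu_1,\dots,\nu_m$, where $p=p_m\in(0,1)$ and $\psi^2=\psi_m^2>0$ satisfy, as $m\to\infty$: $p\to0$; $\psi^2\to\infty$; $v:=\psi^2\big(\frac{1-p}{p}\big)^2\to\infty$; and $\frac{\log v}{\psi^2}\to C$ for some $C\in(0,\infty)$. Consider testing $H_{0i}:\nu_i=0$ against $H_{1i}:\nu_i=1$ simultaneously for $i=1,\dots,m$ by the rule that rejects $H_{0i}$ if and only if $1-E(\kappa_i\mid X_i,\tau)>\frac12$, where the posterior mean is computed under the one-group prior with mixing density $\pi(t)=Kt^{-a-1}L(t)$, $t>0$ (see context). Suppose $\tau=\tau_m>0$ satisfies $\tau\to0$ as $m\to\infty$ and $\lim_{m\to\infty}\tau/p\in(0,\infty)$, and that either (I) $\frac12<a<1$, or (II) $a=\frac12$ and $L(t)/\sqrt{\log t}\to0$ as $t\to\infty$. Then, as $m\to\infty$, the Bayes risk $R_{OG}$ of this multiple testing rule satisfies $$mp\Big[2\Phi\big(\sqrt{2a}\sqrt{C}\big)-1\Big](1+o(1))\ \le\ R_{OG}\ \le\ mp\Big[2\Phi\Big(\sqrt{\tfrac{2aC}{\eta(1-\delta)}}\Big)-1\Big](1+o(1))$$ for every fixed $\eta\in(0,\frac12)$ and $\delta\in(0,1)$. The $o(1)$ terms are not necessarily the same, tend to zero as $m\to\infty$, and depend on the choice of $\eta$ and $\delta$.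
   Context: $\Phi$ is the standard normal distribution function. Two-groups model (data-generating law): for each $m$, $\nu_1,\dots,\nu_m$ are i.i.d. Bernoulli$(p)$, and the pairs $(\nu_i,X_i)$ are independent with $X_i\mid\nu_i=0\sim N(0,1)$ and $X_i\mid\nu_i=1\sim N(0,1+\psi^2)$. "$H_{0i}$ is true" means $\nu_i=0$ and "$H_{1i}$ is true" means $\nu_i=1$. The subscript $m$ is dropped from $p_m,\psi_m,\tau_m$. One-group prior (used only to define the rule): $a>0$ is a real number; $L:(0,\infty)\to(0,\infty)$ is measurable, non-constant and slowly varying, i.e. for every fixed $\alpha>0$, $L(\alpha x)/L(x)\to1$ as $x\to\infty$; and $K\in(0,\infty)$ is such that $\pi(t)=Kt^{-a-1}L(t)$ is a probability density on $(0,\infty)$. For given $\tau>0$: $\lambda_i^2$ are independent with density $\pi$, $\mu_i\mid\lambda_i^2,\tau\sim N(0,\lambda_i^2\tau^2)$ independently, $X_i\mid\mu_i\sim N(\mu_i,1)$ independently, and $\kappa_i=1/(1+\lambda_i^2\tau^2)$. Under this model the posterior density of $\kappa_i$ given $(X_i,\tau)$ is proportional to $\kappa^{a+\frac12-1}(1-\kappa)^{-a-1}L\big(\frac1{\tau^2}(\frac1\kappa-1)\big)e^{-\kappa X_i^2/2}$ on $(0,1)$, and $E(\kappa_i\mid X_i,\tau)$ is the mean of this density. Bayes risk: for a multiple testing rule, let $t_{1i}=\Pr(\text{reject }H_{0i}\mid\nu_i=0)$ and $t_{2i}=\Pr(\text{do not reject }H_{0i}\mid\nu_i=1)$, with probabilities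 under the two-groups model. The Bayes risk is $R=\sum_{i=1}^m\{(1-p)t_{1i}+pt_{2i}\}$. *)

theory Defs
  imports "HOL-Probability.Probability"
begin

definition std_normal_cdf :: "real \<Rightarrow> real"
  where "std_normal_cdf = cdf std_normal_distribution"

definition slowly_varying :: "(real \<Rightarrow> real) \<Rightarrow> bool"
  where "slowly_varying L \<longleftrightarrow> (\<forall>\<alpha>>0. ((\<lambda>x. L (\<alpha> * x) / L x) \<longlongrightarrow> 1) at_top)"

text \<open>The latent indicator \<open>nu i\<close> is \<open>True\<close> iff the alternative \<open>H\<^sub>1\<^sub>i\<close> is true.
  Conditional laws given the indicator are taken under \<^const>\<open>uniform_measure\<close>, i.e. \<open>M\<close>
  conditioned on an event. The second parameter of \<^const>\<open>normal_density\<close> is the standard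
  deviation.\<close>

locale two_groups_model = prob_space M
  for M :: "'w measure" +
  fixes m :: nat and p psi :: real
    and nu :: "nat \<Rightarrow> 'w \<Rightarrow> bool" and X :: "nat \<Rightarrow> 'w \<Rightarrow> real"
  assumes indep: "indep_vars (\<lambda>_. count_space UNIV \<Otimes>\<^sub>M borel) (\<lambda>i w. (nu i w, X i w)) {1..m}"
    and nu_law: "\<And>i. i \<in> {1..m} \<Longrightarrow>
      distr M (count_space UNIV) (nu i) = measure_pmf (bernoulli_pmf p)"
    and X_law_null: "\<And>i. i \<in> {1..m} \<Longrightarrow>
      distributed (uniform_measure M {w \<in> space M. \<not> nu i w}) lborel (X i)
        (\<lambda>x. ennreal (normal_density 0 1 x))"
    and X_law_alt: "\<And>i. i \<in> {1..m} \<Longrightarrow>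
      distributed (uniform_measure M {w \<in> space M. nu i w}) lborel (X i)
        (\<lambda>x. ennreal (normal_density 0 (sqrt (1 + psi\<^sup>2)) x))"

text \<open>A function on \<open>(0,\<infinity>)\<close> is represented by a total function whose values on \<open>(-\<infinity>,0]\<close> are
  irrelevant.\<close>

definition mixing_density :: "real \<Rightarrow> real \<Rightarrow> (real \<Rightarrow> real) \<Rightarrow> real \<Rightarrow> real"
  where "mixing_density a K L t = K * t powr (- a - 1) * L t"

definition one_group_prior :: "real \<Rightarrow> real \<Rightarrow> (real \<Rightarrow> real) \<Rightarrow> bool"
  where "one_group_prior a K L \<longleftrightarrow>
    a > 0 \<and> K > 0 \<and>
    L \<in> borel_measurable (restrict_space borel {0<..}) \<and>
    (\<forall>t>0. L t > 0) \<and>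
    \<not> L constant_on {0<..} \<and>
    slowly_varying L \<and>
    (\<integral>\<^sup>+t\<in>{0<..}. ennreal (mixing_density a K L t) \<partial>lborel) = 1"

text \<open>Posterior of the shrinkage coefficient \<open>\<kappa> = 1 / (1 + \<lambda>\<^sup>2 \<tau>\<^sup>2)\<close> given \<open>X = x\<close> and \<open>\<tau>\<close>, on
  \<open>(0,1)\<close>: the kernel is, up to a factor not depending on \<open>\<kappa>\<close>, the density
  \<open>mixing_density a K L\<close> of \<open>\<lambda>\<^sup>2\<close> transported to \<open>\<kappa>\<close>, times the density of
  \<open>N(0, 1/\<kappa>)\<close> at \<open>x\<close>. The constant \<open>K\<close> cancels in the normalisation.\<close>

definition kappa_kernel :: "real \<Rightarrow> (real \<Rightarrow> real) \<Rightarrow> real \<Rightarrow> real \<Rightarrow> real \<Rightarrow> real"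
  where "kappa_kernel a L \<tau> x \<kappa> =
    \<kappa> powr (a + 1/2 - 1) * (1 - \<kappa>) powr (- a - 1) * L (1 / \<tau>\<^sup>2 * (1 / \<kappa> - 1)) * exp (- \<kappa> * x\<^sup>2 / 2)"

definition kappa_density :: "real \<Rightarrow> (real \<Rightarrow> real) \<Rightarrow> real \<Rightarrow> real \<Rightarrow> real \<Rightarrow> real"
  where "kappa_density a L \<tau> x \<kappa> =
    kappa_kernel a L \<tau> x \<kappa> / (LINT k:{0<..<1}|lborel. kappa_kernel a L \<tau> x k)"

definition kappa_mean :: "real \<Rightarrow> (real \<Rightarrow> real) \<Rightarrow> real \<Rightarrow> real \<Rightarrow> real"
  where "kappa_mean a L \<tau> x = (LINT \<kappa>:{0<..<1}|lborel. \<kappa> * kappa_density a L \<tau> x \<kappa>)"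

definition og_reject :: "real \<Rightarrow> (real \<Rightarrow> real) \<Rightarrow> real \<Rightarrow> real \<Rightarrow> bool"
  where "og_reject a L \<tau> x \<longleftrightarrow> 1 - kappa_mean a L \<tau> x > 1/2"

definition type1_error :: "'w measure \<Rightarrow> ('w \<Rightarrow> bool) \<Rightarrow> ('w \<Rightarrow> bool) \<Rightarrow> real"
  where "type1_error M nu rej = \<P>(w in M. rej w \<bar> \<not> nu w)"

definition type2_error :: "'w measure \<Rightarrow> ('w \<Rightarrow> bool) \<Rightarrow> ('w \<Rightarrow> bool) \<Rightarrow> real"
  where "type2_error M nu rej = \<P>(w in M. \<not> rej w \<bar> nu w)"

definition bayes_risk ::
    "'w measure \<Rightarrow> nat \<Rightarrow> real \<Rightarrow> (nat \<Rightarrow> 'w \<Rightarrow> bool) \<Rightarrow> (nat \<Rightarrow> 'w \<Rightarrow> bool) \<Rightarrow> real"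
  where "bayes_risk M m p nu rej =
    (\<Sum>i=1..m. (1 - p) * type1_error M (nu i) (rej i) + p * type2_error M (nu i) (rej i))"

end

theory Submission
  imports Defs "HOL-Real_Asymp.Real_Asymp"
begin

text \<open>The substitution \<open>t = (1 / \<kappa> - 1) / \<tau>\<^sup>2\<close> turns the rule into the sign of an integral of
  \<open>(1 - 2 \<kappa>)\<close> against \<open>t powr (- a - 1) * L t\<close> times the likelihood. The integrand is positive
  exactly for \<open>t > 1 / \<tau>\<^sup>2\<close>, so rejection is governed by the tail mass of the prior beyond \<open>1 / \<tau>\<^sup>2\<close>.
  Doubling the argument multiplies this tail by \<open>2 powr (- a)\<close> up to a factor tending to 1; iterating
  and using monotonicity pins the tail between powers with exponents close to \<open>- a\<close>, and no uniform
  convergence theorem for \<open>L\<close> is needed. Hence the rule does not reject when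
  \<open>x\<^sup>2 \<le> 4 b ln (1 / \<tau>)\<close> with \<open>b < a\<close>, and rejects when \<open>x\<^sup>2 \<ge> A ln (1 / \<tau>)\<close> with \<open>A > 8 a\<close>; the choice
  \<open>A = 4 a / (\<eta> (1 - \<delta>))\<close> gives the upper bound. The type I error is bounded by Mills' ratio times
  the tail and is \<open>o(p)\<close>; the type II error gives both main terms, because
  \<open>ln (1 / \<tau>) / (1 + \<psi>\<^sup>2)\<close> tends to \<open>C / 2\<close>.\<close>

section \<open>The rule as the sign of an integral\<close>

text \<open>In the scale \<open>t = \<lambda>\<^sup>2\<close>: \<open>mix\<close> is the prior density without \<open>K\<close>, extended by 0, \<open>shrink\<close> is \<open>\<kappa>\<close>, and
  \<open>lik\<close> is the density of \<open>N(0, 1 / \<kappa>)\<close> at \<open>x\<close> up to a constant.\<close>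

definition mix :: "real \<Rightarrow> (real \<Rightarrow> real) \<Rightarrow> real \<Rightarrow> real"
  where "mix a L t = (if t > 0 then t powr (- a - 1) * L t else 0)"

definition shrink :: "real \<Rightarrow> real \<Rightarrow> real"
  where "shrink \<tau> t = 1 / (1 + \<tau>\<^sup>2 * t)"

definition lik :: "real \<Rightarrow> real \<Rightarrow> real \<Rightarrow> real"
  where "lik \<tau> x t = sqrt (shrink \<tau> t) * exp (- shrink \<tau> t * x\<^sup>2 / 2)"

lemma shrink_measurable [measurable]: "shrink \<tau> \<in> borel_measurable borel"
  unfolding shrink_def by measurable

lemma lik_measurable [measurable]: "lik \<tau> x \<in> borel_measurable borel"
  unfolding lik_def by measurable

lemma shrink_bounds: "t > 0 \<Longrightarrow> \<tau> > 0 \<Longrightarrow> 0 < shrink \<tau> t \<and> shrink \<tau> t < 1"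
  by (simp add: shrink_def divide_simps add_pos_pos)

lemma lik_bounds:
  assumes "t > 0" "\<tau> > 0"
  shows "0 < lik \<tau> x t" "lik \<tau> x t \<le> 1"
  using shrink_bounds[OF assms] unfolding lik_def
  by (auto intro!: mult_le_one real_sqrt_le_1_iff[THEN iffD2])

text \<open>The prior constrains \<open>L\<close> only on the positive half-line. Extension by zero
  turns measurability on that subspace into Borel measurability on the whole line, which integrals
  over \<open>lborel\<close> need.\<close>

lemma measurable_extend_zero:
  fixes L :: "real \<Rightarrow> real"
  assumes "L \<in> borel_measurable (restrict_space borel {0<..})"
  shows "(\<lambda>t. if t > 0 then L t else 0) \<in> borel_measurable borel"
proof -
  have "(\<lambda>t. indicator {0<..} t *\<^sub>R L t) \<in> borel_measurable borel"
    using assms by (subst borel_measurable_restrict_space_iff[symmetric]) auto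
  moreover have "(\<lambda>t. indicator {0<..} t *\<^sub>R L t) = (\<lambda>t. if t > 0 then L t else 0)"
    by (auto simp: fun_eq_iff)
  ultimately show ?thesis by simp
qed

lemma mix_measurable:
  assumes "one_group_prior a K L"
  shows "mix a L \<in> borel_measurable borel"
proof -
  have [measurable]: "(\<lambda>t. if t > 0 then L t else 0) \<in> borel_measurable borel"
    using assms by (intro measurable_extend_zero) (auto simp: one_group_prior_def)
  have "mix a L = (\<lambda>t. t powr (- a - 1) * (if t > 0 then L t else 0))"
    by (auto simp: fun_eq_iff mix_def)
  then show ?thesis by simp
qed

lemma mix_pos: "one_group_prior a K L \<Longrightarrow> t > 0 \<Longrightarrow> mix a L t > 0"
  by (auto simp: mix_def one_group_prior_def)

lemma mix_nonneg: "one_group_prior a K L \<Longrightarrow> mix a L t \<ge> 0"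
  using mix_pos[of a K L t] by (cases "t > 0") (auto simp: mix_def)

text \<open>The normalisation of the prior says that \<open>K * mix a L\<close> has total mass 1;
  dividing by \<open>K > 0\<close> keeps integrability.\<close>

lemma mix_integrable:
  assumes "one_group_prior a K L"
  shows "integrable lborel (mix a L)"
proof -
  note [measurable] = mix_measurable[OF assms]
  have K: "K > 0" using assms by (auto simp: one_group_prior_def)
  have "(\<integral>\<^sup>+t. ennreal (K * mix a L t) \<partial>lborel) =
      (\<integral>\<^sup>+t\<in>{0<..}. ennreal (mixing_density a K L t) \<partial>lborel)"
    by (intro nn_integral_cong) (auto simp: mix_def mixing_density_def mult.assoc)
  also have "\<dots> = 1" using assms by (auto simp: one_group_prior_def)
  finally have "integrable lborel (\<lambda>t. K * mix a L t)"
    using K mix_nonneg[OF assms] by (intro integrableI_nonneg) auto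
  then show ?thesis using K by simp
qed

text \<open>The substitution theorem for absolutely integrable functions is stated for Lebesgue
  measure, the completion of \<open>lborel\<close>. Borel measurability of both integrands lets
  integrability pass between a measure and its completion, so the formula carries over to
  \<open>lborel\<close>.\<close>

lemma set_integral_change_of_variables:
  fixes f g g' :: "real \<Rightarrow> real"
  assumes S: "S \<in> sets borel"
    and der: "\<And>x. x \<in> S \<Longrightarrow> (g has_field_derivative g' x) (at x within S)"
    and inj: "inj_on g S"
    and f: "set_integrable lborel (g ` S) f"
    and meas: "set_borel_measurable borel S (\<lambda>x. \<bar>g' x\<bar> * f (g x))"
  shows "set_integrable lborel S (\<lambda>x. \<bar>g' x\<bar> * f (g x))"
    and "(LINT x:S|lborel. \<bar>g' x\<bar> * f (g x)) = (LINT t:g ` S|lborel. f t)"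
proof -
  have f': "f absolutely_integrable_on (g ` S)"
    using f borel_measurable_integrable[OF f[unfolded set_integrable_def]]
    unfolding set_integrable_def
    by (subst integrable_completion) auto
  have ac: "(\<lambda>x. \<bar>g' x\<bar> * f (g x)) absolutely_integrable_on S \<and>
      integral S (\<lambda>x. \<bar>g' x\<bar> * f (g x)) = integral (g ` S) f"
    using has_absolute_integral_change_of_variables_1'[OF _ der inj, of f "integral (g ` S) f"] S f'
    by auto
  have meas': "(\<lambda>x. indicator S x *\<^sub>R (\<bar>g' x\<bar> * f (g x))) \<in> borel_measurable lborel"
    using meas unfolding set_borel_measurable_def by simp
  show int: "set_integrable lborel S (\<lambda>x. \<bar>g' x\<bar> * f (g x))"
    using ac meas' unfolding set_integrable_def by (subst (asm) integrable_completion) auto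
  show "(LINT x:S|lborel. \<bar>g' x\<bar> * f (g x)) = (LINT t:g ` S|lborel. f t)"
    using set_borel_integral_eq_integral(2)[OF int] set_borel_integral_eq_integral(2)[OF f] ac
    by simp
qed

text \<open>One computation serves both integrals in the posterior mean: \<open>h = 1\<close> gives
  the normalising constant and \<open>h k = k\<close> the numerator, and the factor
  \<open>\<tau> powr (- 2 * a)\<close> cancels in their quotient. On the \<open>t\<close> side the
  integrand is dominated by \<open>mix a L\<close>, because \<open>lik\<close> and \<open>h\<close>
  are bounded by 1 there.\<close>

lemma kappa_kernel_integral:
  assumes prior: "one_group_prior a K L" and \<tau>: "\<tau> > 0"
    and h [measurable]: "h \<in> borel_measurable borel"
    and hb: "\<And>k. 0 < k \<Longrightarrow> k < 1 \<Longrightarrow> \<bar>h k\<bar> \<le> 1"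
  shows "set_integrable lborel {0<..<1} (\<lambda>k. kappa_kernel a L \<tau> x k * h k)"
    and "integrable lborel (\<lambda>t. mix a L t * lik \<tau> x t * h (shrink \<tau> t))"
    and "(LINT k:{0<..<1}|lborel. kappa_kernel a L \<tau> x k * h k) =
      \<tau> powr (- 2 * a) * (LINT t|lborel. mix a L t * lik \<tau> x t * h (shrink \<tau> t))"
proof -
  note [measurable] = mix_measurable[OF prior]
  define g where "g k = 1 / \<tau>\<^sup>2 * (1 / k - 1)" for k :: real
  define g' where "g' k = - 1 / (\<tau>\<^sup>2 * k\<^sup>2)" for k :: real
  define f where "f t = mix a L t * lik \<tau> x t * h (shrink \<tau> t)" for t
  have f_meas [measurable]: "f \<in> borel_measurable borel" unfolding f_def by measurable
  have f0: "f t = 0" if "t \<le> 0" for t using that by (auto simp: f_def mix_def)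
  show int: "integrable lborel (\<lambda>t. mix a L t * lik \<tau> x t * h (shrink \<tau> t))"
  proof (rule Bochner_Integration.integrable_bound[OF mix_integrable[OF prior]])
    show "AE t in lborel. norm (mix a L t * lik \<tau> x t * h (shrink \<tau> t)) \<le> norm (mix a L t)"
    proof (rule AE_I2)
      fix t show "norm (mix a L t * lik \<tau> x t * h (shrink \<tau> t)) \<le> norm (mix a L t)"
      proof (cases "t > 0")
        case True
        have "\<bar>mix a L t\<bar> * (\<bar>lik \<tau> x t\<bar> * \<bar>h (shrink \<tau> t)\<bar>) \<le> \<bar>mix a L t\<bar> * (1 * 1)"
          using lik_bounds[OF True \<tau>, of x] hb shrink_bounds[OF True \<tau>]
          by (intro mult_mono) auto
        then show ?thesis by (simp add: abs_mult mult.assoc)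
      qed (simp add: mix_def)
    qed
  qed measurable
  have gpos: "g k > 0" if "0 < k" "k < 1" for k
    using that \<tau> by (auto simp: g_def divide_simps)
  \<comment> \<open>\<open>shrink \<tau>\<close> and \<open>g\<close> are mutually inverse between
    the half-line and the unit interval, which settles both the image and the injectivity of
    \<open>g\<close>.\<close>
  have sg: "shrink \<tau> (g k) = k" if "0 < k" "k < 1" for k
    using that \<tau> by (simp add: shrink_def g_def)
  have gs: "g (shrink \<tau> t) = t" if "t > 0" for t
    using that \<tau> by (simp add: shrink_def g_def)
  have img: "g ` {0<..<1} = {0<..}"
  proof (intro equalityI subsetI)
    fix t assume "t \<in> g ` {0<..<1}" then show "t \<in> {0<..}" using gpos by auto
  next
    fix t :: real assume "t \<in> {0<..}"
    then show "t \<in> g ` {0<..<1}"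
      using gs[of t] shrink_bounds[of t \<tau>] \<tau> by (intro image_eqI[of _ _ "shrink \<tau> t"]) auto
  qed
  have inj: "inj_on g {0<..<1}"
    by (rule inj_on_inverseI[of _ "shrink \<tau>"]) (auto simp: sg)
  have der: "(g has_field_derivative g' k) (at k within {0<..<1})" if "k \<in> {0<..<1}" for k
  proof -
    have "((\<lambda>k. 1 / \<tau>\<^sup>2 * (1 / k - 1)) has_field_derivative 1 / \<tau>\<^sup>2 * (- 1 / k\<^sup>2)) (at k)"
      using that \<tau> by (auto intro!: derivative_eq_intros simp: power2_eq_square)
    then show ?thesis
      unfolding g_def[abs_def] g'_def by (auto intro: has_field_derivative_at_within)
  qed
  have eq: "kappa_kernel a L \<tau> x k * h k = \<tau> powr (- 2 * a) * (\<bar>g' k\<bar> * f (g k))"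
    if k: "k \<in> {0<..<1}" for k
  proof -
    have k': "0 < k" "k < 1" using k by auto
    have g: "g k = (1 - k) / (\<tau>\<^sup>2 * k)" using k' \<tau> by (simp add: g_def field_simps)
    have t2: "\<tau>\<^sup>2 = \<tau> powr 2" using \<tau> by simp
    have "g k powr (- a - 1) = (1 - k) powr (- a - 1) * (\<tau> powr 2 * k powr 1) powr (a + 1)"
      using k' \<tau> unfolding g t2
      by (subst powr_divide) (auto simp: powr_minus[of _ "a+1", simplified] divide_inverse)
    also have "\<dots> = (1 - k) powr (- a - 1) * (\<tau> powr (2 * (a + 1)) * k powr (a + 1))"
      by (subst powr_mult) (simp_all only: powr_powr mult_1 powr_ge_zero)
    finally have gp: "g k powr (- a - 1) = \<dots>" .
    have g'k: "\<bar>g' k\<bar> = \<tau> powr (-2) * k powr (-2)"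
      using k' \<tau> by (simp add: g'_def powr_minus divide_inverse)
    \<comment> \<open>The exponents of \<open>k\<close> come from the Jacobian, the mixing density
      and the square root in \<open>lik\<close>: \<open>-2 + (a + 1) + 1/2 = a + 1/2 - 1\<close>.
      Those of \<open>\<tau>\<close> add up to \<open>2 * a\<close>, which the prefactor
      cancels.\<close>
    have "\<bar>g' k\<bar> * f (g k) = (\<tau> powr (-2) * \<tau> powr (2 * (a + 1))) * 
       (k powr (-2) * k powr (a + 1) * k powr (1/2)) * (1 - k) powr (- a - 1) * L (g k) *
        exp (- k * x\<^sup>2 / 2) * h k"
      using k' gpos[OF k'] by (simp add: f_def lik_def sg mix_def gp g'k powr_half_sqrt)
    also have "\<dots> = \<tau> powr (2 * a) * k powr (a + 1/2 - 1) * (1 - k) powr (- a - 1) * L (g k) *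
        exp (- k * x\<^sup>2 / 2) * h k"
      by (simp add: powr_add[symmetric] algebra_simps)
    finally show ?thesis
      using \<tau> by (simp add: kappa_kernel_def g_def powr_minus)
  qed
  have "(\<lambda>t. indicator {0<..} t *\<^sub>R f t) = f"
    by (auto simp: fun_eq_iff indicator_def f0 not_less)
  moreover have "integrable lborel f"
    using int by (simp add: f_def[abs_def])
  ultimately have f_int: "set_integrable lborel (g ` {0<..<1}) f"
    unfolding img set_integrable_def by simp
  have meas: "set_borel_measurable borel {0<..<1} (\<lambda>k. \<bar>g' k\<bar> * f (g k))"
    unfolding set_borel_measurable_def g_def g'_def by measurable
  note cv = set_integral_change_of_variables[OF _ der inj f_int meas]
  have "set_integrable lborel {0<..<1} (\<lambda>k. \<tau> powr (- 2 * a) * (\<bar>g' k\<bar> * f (g k)))"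
    by (intro set_integrable_mult_right cv(1)) (auto simp: img)
  then show "set_integrable lborel {0<..<1} (\<lambda>k. kappa_kernel a L \<tau> x k * h k)"
    by (subst set_integrable_cong[OF refl refl eq]) auto
  have "(LINT k:{0<..<1}|lborel. kappa_kernel a L \<tau> x k * h k) =
      (LINT k:{0<..<1}|lborel. \<tau> powr (- 2 * a) * (\<bar>g' k\<bar> * f (g k)))"
    by (rule set_lebesgue_integral_cong) (auto simp: eq)
  also have "\<dots> = \<tau> powr (- 2 * a) * (LINT t:g ` {0<..<1}|lborel. f t)"
    by (subst set_integral_mult_right, subst cv(2)) (auto simp: img)
  also have "(LINT t:g ` {0<..<1}|lborel. f t) = (LINT t|lborel. f t)"
    unfolding img set_lebesgue_integral_def
    by (rule Bochner_Integration.integral_cong) (auto simp: indicator_def f0 not_less)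
  finally show "(LINT k:{0<..<1}|lborel. kappa_kernel a L \<tau> x k * h k) =
      \<tau> powr (- 2 * a) * (LINT t|lborel. mix a L t * lik \<tau> x t * h (shrink \<tau> t))"
    by (simp add: f_def)
qed

text \<open>A nonnegative integrable function with integral 0 vanishes almost everywhere, which is
  impossible on an interval of positive length.\<close>

lemma integral_pos_of_pos_on:
  fixes f :: "real \<Rightarrow> real"
  assumes "integrable lborel f" "\<And>t. f t \<ge> 0" "\<And>t. l < t \<Longrightarrow> t < u \<Longrightarrow> f t > 0" "l < u"
  shows "(LINT t|lborel. f t) > 0"
proof -
  have "\<not> (AE t in lborel. f t = 0)"
  proof
    assume "AE t in lborel. f t = 0"
    then have "AE t in lborel. t \<notin> {l<..<u}"
      by eventually_elim (use assms(3) in force)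
    then have "emeasure lborel {l<..<u} = 0"
      by (subst (asm) AE_iff_measurable[of "{l<..<u}"]) auto
    then show False using assms(4) by simp
  qed
  then show ?thesis
    using integral_nonneg_eq_0_iff_AE[OF assms(1)] assms(2)
      Bochner_Integration.integral_nonneg[of lborel f] by (force simp: order_less_le)
qed

text \<open>The odds form of the rule avoids dividing by the normalising constant.\<close>

lemma og_reject_iff:
  assumes prior: "one_group_prior a K L" and \<tau>: "\<tau> > 0"
  shows "og_reject a L \<tau> x \<longleftrightarrow>
    (LINT t|lborel. mix a L t * lik \<tau> x t * (1 - 2 * shrink \<tau> t)) > 0"
proof -
  define I where "I h = (LINT t|lborel. mix a L t * lik \<tau> x t * h (shrink \<tau> t))" for h :: "real \<Rightarrow> real"
  note k1 = kappa_kernel_integral[OF prior \<tau>, of "\<lambda>_. 1" x, simplified]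
  note k2 = kappa_kernel_integral[OF prior \<tau>, of "\<lambda>k. k" x, simplified]
  have I1: "(LINT k:{0<..<1}|lborel. kappa_kernel a L \<tau> x k) = \<tau> powr (- 2 * a) * I (\<lambda>_. 1)"
    using k1 by (simp add: I_def)
  have I2: "(LINT k:{0<..<1}|lborel. kappa_kernel a L \<tau> x k * k) = \<tau> powr (- 2 * a) * I (\<lambda>k. k)"
    using k2 by (simp add: I_def)
  have pos: "I (\<lambda>_. 1) > 0"
    unfolding I_def
  proof (rule integral_pos_of_pos_on[of _ 0 1])
    show "mix a L t * lik \<tau> x t * 1 \<ge> 0" for t
      using mix_pos[OF prior, of t] lik_bounds(1)[OF _ \<tau>, of t x]
      by (cases "t > 0") (auto simp: mix_def less_imp_le)
  qed (use k1(2) mix_pos[OF prior] lik_bounds(1)[OF _ \<tau>] in auto)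
  have "kappa_mean a L \<tau> x = (LINT k:{0<..<1}|lborel. kappa_kernel a L \<tau> x k * k) /
      (LINT k:{0<..<1}|lborel. kappa_kernel a L \<tau> x k)"
    (is "_ = _ / ?Z")
  proof -
    have "(\<lambda>k. k * (kappa_kernel a L \<tau> x k / ?Z)) = (\<lambda>k. kappa_kernel a L \<tau> x k * k / ?Z)"
      by (auto simp: fun_eq_iff)
    then show ?thesis
      unfolding kappa_mean_def kappa_density_def by (simp only: set_integral_divide_zero)
  qed
  also have "\<dots> = I (\<lambda>k. k) / I (\<lambda>_. 1)"
    unfolding I1 I2 using \<tau> by simp
  finally have mean: "kappa_mean a L \<tau> x = I (\<lambda>k. k) / I (\<lambda>_. 1)" .
  have "og_reject a L \<tau> x \<longleftrightarrow> I (\<lambda>_. 1) - 2 * I (\<lambda>k. k) > 0"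
    unfolding og_reject_def mean using pos by (simp add: field_simps)
  also have "I (\<lambda>_. 1) - 2 * I (\<lambda>k. k) =
      (LINT t|lborel. mix a L t * lik \<tau> x t * 1 - 2 * (mix a L t * lik \<tau> x t * shrink \<tau> t))"
    unfolding I_def using k1(2) k2(2) by simp
  finally show ?thesis by (simp add: algebra_simps)
qed

section \<open>Tail mass of the prior\<close>

definition tail :: "real \<Rightarrow> (real \<Rightarrow> real) \<Rightarrow> real \<Rightarrow> real"
  where "tail a L y = (LINT t|lborel. indicator {y<..} t * mix a L t)"

lemma mix_indicator_integrable:
  assumes "one_group_prior a K L" "A \<in> sets borel"
  shows "integrable lborel (\<lambda>t. indicator A t * mix a L t)"
  using integrable_mult_indicator[of A lborel "mix a L"] mix_integrable[OF assms(1)] assms(2) by simp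

lemma tail_pos:
  assumes "one_group_prior a K L" "y > 0"
  shows "tail a L y > 0"
  unfolding tail_def
  using mix_nonneg[OF assms(1)] mix_pos[OF assms(1)] assms(2)
  by (intro integral_pos_of_pos_on[of _ y "y + 1"] mix_indicator_integrable[OF assms(1)]) auto

lemma tail_antimono:
  assumes "one_group_prior a K L" "y \<le> z"
  shows "tail a L z \<le> tail a L y"
  unfolding tail_def
  using mix_nonneg[OF assms(1)] assms(2)
  by (intro integral_mono mix_indicator_integrable[OF assms(1)]) (auto simp: indicator_def)

text \<open>Substituting \<open>2 * t\<close> puts both tails on the same half-line, so that they
  can be compared through their integrands. The factor 2 in front of \<open>mix\<close> is the
  Jacobian.\<close>

lemma tail_scale:
  assumes "y > 0"
  shows "tail a L (2 * y) = (LINT t|lborel. indicator {y<..} t * (2 * mix a L (2 * t)))"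
  unfolding tail_def
  by (subst lborel_integral_real_affine[of 2 _ 0])
    (auto simp: indicator_def mult.left_commute)

lemma mix_scale_integrable:
  assumes "one_group_prior a K L"
  shows "integrable lborel (\<lambda>t. indicator {y<..} t * (2 * mix a L (2 * t)))"
  using lborel_integrable_real_affine[OF mix_indicator_integrable[OF assms, of "{2*y<..}"], of 2 0]
  by (simp add: indicator_def mult.left_commute)

text \<open>Slow variation at the single ratio 2 compares the integrands of the two tails pointwise
  beyond a threshold; integrating preserves the comparison.\<close>

lemma tail_double:
  assumes prior: "one_group_prior a K L" and e: "e > 0"
  shows "\<forall>\<^sub>F y in at_top. (1 - e) * 2 powr (-a) * tail a L y \<le> tail a L (2 * y) \<and>
    tail a L (2 * y) \<le> (1 + e) * 2 powr (-a) * tail a L y"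
proof -
  have "((\<lambda>x. L (2 * x) / L x) \<longlongrightarrow> 1) at_top"
    using prior by (auto simp: one_group_prior_def slowly_varying_def)
  then have "\<forall>\<^sub>F x in at_top. dist (L (2 * x) / L x) 1 < e"
    using e by (rule tendstoD)
  then obtain Y0 where Y0: "\<And>x. x \<ge> Y0 \<Longrightarrow> dist (L (2 * x) / L x) 1 < e"
    by (auto simp: eventually_at_top_linorder)
  have ratio: "(1 - e) * 2 powr (-a) * mix a L t \<le> 2 * mix a L (2 * t) \<and>
      2 * mix a L (2 * t) \<le> (1 + e) * 2 powr (-a) * mix a L t" if "t > 0" "t \<ge> Y0" for t
  proof -
    have Lt: "L t > 0" using prior that by (auto simp: one_group_prior_def)
    have "(1 - e) * L t \<le> L (2 * t) \<and> L (2 * t) \<le> (1 + e) * L t"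
      using Y0[of t] that Lt by (auto simp: dist_real_def abs_less_iff field_simps)
    \<comment> \<open>The Jacobian and the power combine to
      \<open>2 * 2 powr (- a - 1) = 2 powr (- a)\<close>.\<close>
    moreover have "2 * mix a L (2 * t) = (2 powr (-a) * t powr (- a - 1)) * L (2 * t)"
      using that by (simp add: mix_def powr_mult powr_diff)
    moreover have "mix a L t = t powr (- a - 1) * L t" using that by (simp add: mix_def)
    ultimately show ?thesis
      using mult_left_mono[of "(1 - e) * L t" "L (2 * t)" "2 powr (-a) * t powr (- a - 1)"]
        mult_left_mono[of "L (2 * t)" "(1 + e) * L t" "2 powr (-a) * t powr (- a - 1)"]
      by (auto simp: mult_ac)
  qed
  show ?thesis
    using eventually_gt_at_top[of 0] eventually_ge_at_top[of Y0]
  proof eventually_elim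
    case (elim y)
    have *: "c * 2 powr (-a) * tail a L y = (LINT t|lborel. c * 2 powr (-a) * (indicator {y<..} t * mix a L t))" for c
      by (simp add: tail_def)
    show ?case
      unfolding * tail_scale[OF elim(1)]
      using ratio elim mix_indicator_integrable[OF prior, of "{y<..}"]
      by (intro conjI integral_mono mix_scale_integrable[OF prior]) (auto simp: indicator_def)
  qed
qed

section \<open>Power bounds from iterated doubling\<close>

lemma dyadic_bracket:
  fixes y Y :: real
  assumes "0 < Y" "Y \<le> y"
  obtains n :: nat where "2 ^ n * Y \<le> y" "y < 2 ^ Suc n * Y"
proof -
  obtain k :: nat where k: "y / Y < 2 ^ k" using real_arch_pow[of 2 "y / Y"] by auto
  define n where "n = (LEAST k. y < 2 ^ k * Y)"
  have ex: "y < 2 ^ k * Y" using k assms by (simp add: field_simps)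
  have n: "y < 2 ^ n * Y" unfolding n_def by (rule LeastI[of _ k]) (rule ex)
  \<comment> \<open>The bracketing index is the predecessor of the least exponent; it exists because
    \<open>Y \<le> y\<close> rules out exponent 0.\<close>
  have "n \<noteq> 0" using n assms by (intro notI) simp
  then obtain m where m: "n = Suc m" by (cases n) auto
  have "\<not> y < 2 ^ m * Y" using not_less_Least[of m "\<lambda>k. y < 2 ^ k * Y"] m n_def by auto
  then show ?thesis using that[of m] n m by auto
qed

text \<open>Iterating the doubling inequality from \<open>Y\<close> controls \<open>g\<close> at the
  points \<open>2 ^ n * Y\<close>. Between two of them monotonicity compares \<open>g y\<close> with
  the value at the lower point, at the cost of a constant only.\<close>

lemma dyadic_upper:
  fixes g :: "real \<Rightarrow> real"
  assumes anti: "\<And>y z. 0 < y \<Longrightarrow> y \<le> z \<Longrightarrow> g z \<le> g y" and pos: "\<And>y. 0 < y \<Longrightarrow> g y > 0"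
    and dbl: "\<forall>\<^sub>F y in at_top. g (2 * y) \<le> 2 powr (-b) * g y" and b: "b \<ge> 0"
  shows "\<exists>C>0. \<forall>\<^sub>F y in at_top. g y \<le> C * y powr (-b)"
proof -
  obtain Y0 where Y0: "\<And>y. y \<ge> Y0 \<Longrightarrow> g (2 * y) \<le> 2 powr (-b) * g y"
    using dbl by (auto simp: eventually_at_top_linorder)
  define Y where "Y = max 1 Y0"
  have Y: "Y > 0" "Y \<ge> Y0" by (auto simp: Y_def)
  have it: "g (2 ^ n * Y) \<le> (2 ^ n) powr (-b) * g Y" for n
  proof (induction n)
    case (Suc n)
    have "1 * Y \<le> 2 ^ n * Y" using Y by (intro mult_right_mono) auto
    then have "Y0 \<le> 2 ^ n * Y" using Y by linarith
    then have "g (2 * (2 ^ n * Y)) \<le> 2 powr (-b) * g (2 ^ n * Y)"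
      by (rule Y0)
    also have "\<dots> \<le> 2 powr (-b) * ((2 ^ n) powr (-b) * g Y)"
      using Suc by (intro mult_left_mono) auto
    finally show ?case by (simp add: powr_mult mult_ac)
  qed (use Y in auto)
  \<comment> \<open>From \<open>y < 2 ^ Suc n * Y\<close> it follows that
    \<open>2 ^ n > y / (2 * Y)\<close>; the constant collects what this leaves beside
    \<open>y powr (-b)\<close>.\<close>
  define C where "C = g Y * (2 * Y) powr b"
  have "g y \<le> C * y powr (-b)" if y: "y \<ge> Y" for y
  proof -
    obtain n where n: "2 ^ n * Y \<le> y" "y < 2 ^ Suc n * Y"
      using dyadic_bracket[OF Y(1) y] by blast
    have "g y \<le> g (2 ^ n * Y)" using n Y by (intro anti) auto
    also have "\<dots> \<le> (2 ^ n) powr (-b) * g Y" by (rule it)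
    also have "(2 ^ n) powr (-b) \<le> (y / (2 * Y)) powr (-b)"
      using n Y y b by (intro powr_mono2') (auto simp: field_simps)
    also have "(y / (2 * Y)) powr (-b) = y powr (-b) * (2 * Y) powr b"
      using Y y by (simp add: powr_divide powr_minus field_simps)
    finally show ?thesis using pos[OF Y(1)] by (simp add: C_def mult_ac)
  qed
  moreover have "C > 0" using pos[OF Y(1)] Y by (simp add: C_def)
  ultimately show ?thesis by (auto simp: eventually_at_top_linorder)
qed

text \<open>The mirror image of the upper bound: here \<open>g y\<close> is compared with the value
  at the next dyadic point above \<open>y\<close>.\<close>

lemma dyadic_lower:
  fixes g :: "real \<Rightarrow> real"
  assumes anti: "\<And>y z. 0 < y \<Longrightarrow> y \<le> z \<Longrightarrow> g z \<le> g y" and pos: "\<And>y. 0 < y \<Longrightarrow> g y > 0"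
    and dbl: "\<forall>\<^sub>F y in at_top. g (2 * y) \<ge> 2 powr (-b) * g y" and b: "b \<ge> 0"
  shows "\<exists>C>0. \<forall>\<^sub>F y in at_top. g y \<ge> C * y powr (-b)"
proof -
  obtain Y0 where Y0: "\<And>y. y \<ge> Y0 \<Longrightarrow> g (2 * y) \<ge> 2 powr (-b) * g y"
    using dbl by (auto simp: eventually_at_top_linorder)
  define Y where "Y = max 1 Y0"
  have Y: "Y > 0" "Y \<ge> Y0" by (auto simp: Y_def)
  have it: "g (2 ^ n * Y) \<ge> (2 ^ n) powr (-b) * g Y" for n
  proof (induction n)
    case (Suc n)
    have "1 * Y \<le> 2 ^ n * Y" using Y by (intro mult_right_mono) auto
    then have "Y0 \<le> 2 ^ n * Y" using Y by linarith
    have "2 powr (-b) * ((2 ^ n) powr (-b) * g Y) \<le> 2 powr (-b) * g (2 ^ n * Y)"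
      using Suc by (intro mult_left_mono) auto
    also have "\<dots> \<le> g (2 * (2 ^ n * Y))" by (rule Y0) fact
    finally show ?case by (simp add: powr_mult mult_ac)
  qed (use Y in auto)
  \<comment> \<open>The point above \<open>y\<close> satisfies
    \<open>2 ^ Suc n \<le> 2 * y / Y\<close>, whence the factor \<open>Y / 2\<close>.\<close>
  define C where "C = g Y * (Y / 2) powr b"
  have "g y \<ge> C * y powr (-b)" if y: "y \<ge> Y" for y
  proof -
    obtain n where n: "2 ^ n * Y \<le> y" "y < 2 ^ Suc n * Y"
      using dyadic_bracket[OF Y(1) y] by blast
    have "C * y powr (-b) = (2 * y / Y) powr (-b) * g Y"
      using Y y by (simp add: C_def powr_divide powr_mult powr_minus field_simps)
    also have "(2 * y / Y) powr (-b) \<le> (2 ^ Suc n) powr (-b)"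
      using n Y y b by (intro powr_mono2') (auto simp: field_simps)
    also have "(2 ^ Suc n) powr (-b) * g Y \<le> g (2 ^ Suc n * Y)" by (rule it)
    also have "\<dots> \<le> g y" using n Y y by (intro anti) auto
    finally show ?thesis using pos[OF Y(1)] by (simp add: mult_right_mono)
  qed
  moreover have "C > 0" using pos[OF Y(1)] Y by (simp add: C_def)
  ultimately show ?thesis by (auto simp: eventually_at_top_linorder)
qed

lemma tail_upper:
  assumes prior: "one_group_prior a K L" and b: "0 \<le> b" "b < a"
  shows "\<exists>C>0. \<forall>\<^sub>F y in at_top. tail a L y \<le> C * y powr (-b)"
proof (rule dyadic_upper)
  \<comment> \<open>This is the error for which \<open>(1 + e) * 2 powr (-a)\<close> is exactly
    \<open>2 powr (-b)\<close>.\<close>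
  have e: "2 powr (a - b) - 1 > (0::real)" using b by simp
  show "\<forall>\<^sub>F y in at_top. tail a L (2 * y) \<le> 2 powr - b * tail a L y"
    using tail_double[OF prior e] by eventually_elim (simp add: powr_add[symmetric])
qed (use tail_antimono[OF prior] tail_pos[OF prior] b in auto)

lemma tail_lower:
  assumes prior: "one_group_prior a K L" and b: "a < b"
  shows "\<exists>C>0. \<forall>\<^sub>F y in at_top. tail a L y \<ge> C * y powr (-b)"
proof (rule dyadic_lower)
  \<comment> \<open>This is the error for which \<open>(1 - e) * 2 powr (-a)\<close> is exactly
    \<open>2 powr (-b)\<close>.\<close>
  have e: "1 - 2 powr (a - b) > (0::real)" using b powr_less_mono[of "a - b" 0 2] by simp
  show "\<forall>\<^sub>F y in at_top. tail a L (2 * y) \<ge> 2 powr - b * tail a L y"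
    using tail_double[OF prior e] by eventually_elim (simp add: powr_add[symmetric])
  show "b \<ge> 0" using b prior by (auto simp: one_group_prior_def)
qed (use tail_antimono[OF prior] tail_pos[OF prior] in auto)

lemma tail_diff:
  assumes prior: "one_group_prior a K L" and "y > 0"
  shows "tail a L y - tail a L (2 * y) = (LINT t|lborel. indicator {y<..2*y} t * mix a L t)"
proof -
  have "tail a L y - tail a L (2 * y) =
      (LINT t|lborel. indicator {y<..} t * mix a L t - indicator {2*y<..} t * mix a L t)"
    unfolding tail_def
    by (rule Bochner_Integration.integral_diff[symmetric]; rule mix_indicator_integrable[OF prior]) auto
  also have "\<dots> = (LINT t|lborel. indicator {y<..2*y} t * mix a L t)"
    using assms(2) by (intro Bochner_Integration.integral_cong) (auto simp: indicator_def)
  finally show ?thesis .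
qed

text \<open>Doubling shrinks the tail by a factor close to \<open>2 powr (-a)\<close>, hence
  eventually by at least \<open>2 powr (-(a/2)) < 1\<close>. A single dyadic block therefore carries
  a fixed fraction of the tail, so that the tail can be estimated from above or below through one
  block.\<close>

lemma tail_le_diff:
  assumes prior: "one_group_prior a K L"
  shows "\<exists>c>0. \<forall>\<^sub>F y in at_top. tail a L y - tail a L (2 * y) \<ge> c * tail a L y"
proof -
  have a: "a > 0" using prior by (auto simp: one_group_prior_def)
  have e: "2 powr (a / 2) - 1 > (0::real)" using a by simp
  have "\<forall>\<^sub>F y in at_top. tail a L y - tail a L (2 * y) \<ge> (1 - 2 powr (-(a/2))) * tail a L y"
    using tail_double[OF prior e]
    by eventually_elim (simp add: powr_add[symmetric] algebra_simps)
  moreover have "1 - 2 powr (-(a/2)) > (0::real)" using a powr_less_mono[of "-(a/2)" 0 2] by simp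
  ultimately show ?thesis by blast
qed

text \<open>At the boundary exponent the bounds with \<open>b < 1/2\<close> are too weak, and the
  growth condition on \<open>L\<close> has to enter. By the preceding lemma it suffices to bound the
  mass of one dyadic block, where \<open>L\<close> is controlled pointwise and the power is at most
  its value at \<open>y\<close>.\<close>

lemma tail_half:
  assumes prior: "one_group_prior (1/2) K L"
    and L: "((\<lambda>t. L t / sqrt (ln t)) \<longlongrightarrow> 0) at_top" and e: "e > 0"
  shows "\<forall>\<^sub>F y in at_top. tail (1/2) L y \<le> e * y powr (-1/2) * sqrt (ln y)"
proof -
  obtain c where c: "c > 0"
    "\<forall>\<^sub>F y in at_top. tail (1/2) L y - tail (1/2) L (2 * y) \<ge> c * tail (1/2) L y"
    using tail_le_diff[OF prior] by blast
  \<comment> \<open>The division by 2 pays for \<open>sqrt (2 * ln y) \<le> 2 * sqrt (ln y)\<close>,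
    and \<open>c\<close> for the passage from the block to the whole tail.\<close>
  define d where "d = e * c / 2"
  have d: "d > 0" using c e by (simp add: d_def)
  have "\<forall>\<^sub>F t in at_top. dist (L t / sqrt (ln t)) 0 < d"
    using L d by (rule tendstoD)
  then obtain Y0 where Y0: "\<And>x. x \<ge> Y0 \<Longrightarrow> \<bar>L x / sqrt (ln x)\<bar> < d"
    by (auto simp: eventually_at_top_linorder)
  show ?thesis
    using c(2) eventually_ge_at_top[of Y0] eventually_ge_at_top[of 2]
  proof eventually_elim
    case (elim y)
    have bound: "mix (1/2) L t \<le> y powr (-3/2) * (d * sqrt (2 * ln y))" if "t \<in> {y<..2*y}" for t
    proof -
      have t: "t > 1" "t \<ge> Y0" "t \<ge> y" "t \<le> 2 * y" using that elim by auto
      have "L t / sqrt (ln t) < d" using Y0[OF t(2)] by (rule order.strict_trans1[OF abs_ge_self])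
      then have "L t \<le> d * sqrt (ln t)" using t by (simp add: field_simps)
      also have "ln t \<le> ln (2 * y)" using t by simp
      \<comment> \<open>This uses \<open>y \<ge> 2\<close>.\<close>
      also have "ln (2 * y) \<le> 2 * ln y" using elim by (simp add: ln_mult)
      finally have "L t \<le> d * sqrt (2 * ln y)" using d by simp
      moreover have "t powr (-3/2) \<le> y powr (-3/2)" using t elim by (intro powr_mono2') auto
      moreover have "mix (1/2) L t = t powr (-3/2) * L t" using t by (simp add: mix_def)
      moreover have "L t > 0" using prior t by (auto simp: one_group_prior_def)
      ultimately show ?thesis by (auto intro!: mult_mono)
    qed
    have "c * tail (1/2) L y \<le> (LINT t|lborel. indicator {y<..2*y} t * mix (1/2) L t)"
      using elim tail_diff[OF prior, of y] by simp
    also have "\<dots> \<le> (LINT t|lborel. indicator {y<..2*y} t * (y powr (-3/2) * (d * sqrt (2 * ln y))))"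
    proof (rule integral_mono)
      show "integrable lborel (\<lambda>t. indicator {y<..2*y} t * (y powr (-3/2) * (d * sqrt (2 * ln y))))"
        using elim by (intro integrable_mult_left integrable_real_indicator) auto
    qed (use bound mix_indicator_integrable[OF prior, of "{y<..2*y}"] in \<open>auto simp: indicator_def\<close>)
    also have "\<dots> = y * y powr (-3/2) * d * sqrt (2 * ln y)"
      using elim by simp
    also have "y * y powr (-3/2) = y powr (-1/2)"
      using elim powr_add[of y 1 "-3/2"] by simp
    also have "\<dots> * d * sqrt (2 * ln y) \<le> y powr (-1/2) * d * (2 * sqrt (ln y))"
      using d elim by (intro mult_left_mono) (auto simp: real_sqrt_mult sqrt2_less_2 less_imp_le)
    also have "\<dots> = c * (e * y powr (-1/2) * sqrt (ln y))" by (simp add: d_def)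
    finally show ?case using c(1) by simp
  qed
qed

section \<open>Location of the rejection threshold\<close>

lemma filterlim_scale_inverse_square:
  "u > 0 \<Longrightarrow> filterlim (\<lambda>\<tau>::real. u * (1 / \<tau>\<^sup>2)) at_top (at_right 0)"
  by real_asymp

lemma inverse_square_powr:
  "(1 / \<tau>\<^sup>2) powr b = \<tau> powr (- 2 * b)" if "\<tau> > (0::real)"
proof -
  have "1 / \<tau>\<^sup>2 = \<tau> powr (-2)" using that by (simp add: powr_minus divide_inverse)
  then show ?thesis by (simp add: powr_powr)
qed

lemma odds_integrable:
  assumes prior: "one_group_prior a K L" and \<tau>: "\<tau> > 0"
  shows "integrable lborel (\<lambda>t. mix a L t * lik \<tau> x t * (1 - 2 * shrink \<tau> t))"
proof -
  have "integrable lborel (\<lambda>t. mix a L t * lik \<tau> x t * 1 - 2 * (mix a L t * lik \<tau> x t * shrink \<tau> t))"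
    using kappa_kernel_integral(2)[OF prior \<tau>, of "\<lambda>_. 1" x]
      kappa_kernel_integral(2)[OF prior \<tau>, of "\<lambda>k. k" x]
    by (intro Bochner_Integration.integrable_diff integrable_mult_right) auto
  then show ?thesis by (simp add: algebra_simps)
qed

text \<open>Rejection means that the positive part of the odds integral outweighs the negative part.
  The positive part is at most the tail beyond \<open>1 / \<tau>\<^sup>2\<close>, and the negative
  part is at least \<open>exp (- x\<^sup>2 / 2)\<close> times a constant, already from the prior
  mass on \<open>{0<..1}\<close>.\<close>

lemma og_reject_tail:
  assumes prior: "one_group_prior a K L"
  shows "\<exists>c>0. \<forall>\<^sub>F \<tau> in at_right 0. \<forall>x. og_reject a L \<tau> x \<longrightarrow>
    exp (- x\<^sup>2 / 2) < c * tail a L (1 / \<tau>\<^sup>2)"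
proof -
  define F where "F = (LINT t|lborel. indicator {0<..1} t * mix a L t)"
  have F: "F > 0"
    unfolding F_def using mix_nonneg[OF prior] mix_pos[OF prior]
    by (intro integral_pos_of_pos_on[of _ 0 1] mix_indicator_integrable[OF prior]) auto
  have "\<forall>\<^sub>F \<tau> in at_right 0. \<forall>x. og_reject a L \<tau> x \<longrightarrow>
    exp (- x\<^sup>2 / 2) < 4 / F * tail a L (1 / \<tau>\<^sup>2)"
    using eventually_at_right_less[of 0]
      filterlim_at_top_gt[THEN iffD1, OF filterlim_scale_inverse_square[of 1], rule_format, of 0 3, simplified]
  proof eventually_elim
    case (elim \<tau>)
    show ?case
    proof (intro allI impI)
      fix x assume rej: "og_reject a L \<tau> x"
      define y where "y = 1 / \<tau>\<^sup>2"
      \<comment> \<open>For \<open>t \<le> 1\<close> this gives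
        \<open>shrink \<tau> t \<ge> 1 / (1 + 1/3) = 3/4\<close>, so that
        \<open>2 * shrink \<tau> t - 1 \<ge> 1/2\<close>.\<close>
      have y: "y \<ge> 3" using elim rej by (simp add: y_def)
      have \<tau>: "\<tau> > 0" by fact
      have \<tau>y: "\<tau>\<^sup>2 = 1 / y" by (simp add: y_def)
      note int = odds_integrable[OF prior \<tau>, of x]
      \<comment> \<open>Beyond \<open>y\<close> the two factors next to \<open>mix\<close> have
        product at most 1. Between 1 and \<open>y\<close> the integrand is nonpositive and is
        dropped. On \<open>{0<..1}\<close> the lower bounds 1/2 for
        \<open>sqrt (shrink \<tau> t)\<close> and for \<open>2 * shrink \<tau> t - 1\<close> give
        the factor 1/4.\<close>
      have pw: "mix a L t * lik \<tau> x t * (1 - 2 * shrink \<tau> t) \<le>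
          indicator {y<..} t * mix a L t - exp (- x\<^sup>2 / 2) / 4 * (indicator {0<..1} t * mix a L t)" for t
      proof (cases "t > 0")
        case True
        note s = shrink_bounds[OF True \<tau>] and l = lik_bounds[OF True \<tau>, of x] and m = mix_pos[OF prior True]
        consider "t > y" | "1 < t" "t \<le> y" | "t \<le> 1" by linarith
        then show ?thesis
        proof cases
          case 1
          have "lik \<tau> x t * (1 - 2 * shrink \<tau> t) \<le> 1"
            using s l mult_mono[of "lik \<tau> x t" 1 "1 - 2 * shrink \<tau> t" 1]
            by (cases "1 - 2 * shrink \<tau> t \<ge> 0") (auto intro: order.trans[OF mult_nonneg_nonpos])
          then show ?thesis using 1 y m by (simp add: mult.assoc)
        next
          case 2
          have "shrink \<tau> t \<ge> 1 / 2" using 2 y by (simp add: shrink_def \<tau>y field_simps)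
          then show ?thesis using 2 y m l by (simp add: mult_nonneg_nonpos)
        next
          case 3
          have s34: "shrink \<tau> t \<ge> 3 / 4" using 3 True y by (simp add: shrink_def \<tau>y field_simps)
          have "sqrt (shrink \<tau> t) \<ge> 1 / 2"
            using s34 by (intro real_le_rsqrt) (simp add: power2_eq_square)
          moreover have "exp (- shrink \<tau> t * x\<^sup>2 / 2) \<ge> exp (- x\<^sup>2 / 2)"
            using s mult_right_mono[of "shrink \<tau> t" 1 "x\<^sup>2"] by simp
          ultimately have "lik \<tau> x t \<ge> 1 / 2 * exp (- x\<^sup>2 / 2)"
            using s unfolding lik_def by (intro mult_mono) auto
          then have "lik \<tau> x t * (2 * shrink \<tau> t - 1) \<ge> (1 / 2 * exp (- x\<^sup>2 / 2)) * (1 / 2)"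
            using s34 l by (intro mult_mono) auto
          then have "mix a L t * (lik \<tau> x t * (2 * shrink \<tau> t - 1)) \<ge> mix a L t * (exp (- x\<^sup>2 / 2) / 4)"
            using m by (intro mult_left_mono) auto
          then show ?thesis using 3 y True by (simp add: algebra_simps)
        qed
      qed (simp add: mix_def)
      have "0 < (LINT t|lborel. mix a L t * lik \<tau> x t * (1 - 2 * shrink \<tau> t))"
        using elim rej og_reject_iff[OF prior \<tau>] by simp
      also have "\<dots> \<le> (LINT t|lborel. indicator {y<..} t * mix a L t -
          exp (- x\<^sup>2 / 2) / 4 * (indicator {0<..1} t * mix a L t))"
        by (intro integral_mono int pw Bochner_Integration.integrable_diff integrable_mult_right
            mix_indicator_integrable[OF prior]) auto
      also have "\<dots> = tail a L y - exp (- x\<^sup>2 / 2) / 4 * F"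
        unfolding tail_def F_def
        by (subst Bochner_Integration.integral_diff)
          (auto intro!: integrable_mult_right mix_indicator_integrable[OF prior] simp del: indicator_simps)
      finally show "exp (- x\<^sup>2 / 2) < 4 / F * tail a L (1 / \<tau>\<^sup>2)" using F by (simp add: y_def field_simps)
    qed
  qed
  then show ?thesis using F by (intro exI[of _ "4 / F"]) auto
qed

text \<open>Rejection forces \<open>exp (- x\<^sup>2 / 2)\<close> below a multiple of the tail at
  \<open>1 / \<tau>\<^sup>2\<close>, which is of order \<open>\<tau> powr (2 * b1)\<close> at most
  for any \<open>b1 < a\<close>; taking logarithms gives the threshold.\<close>

lemma og_reject_lower:
  assumes prior: "one_group_prior a K L" and b: "0 \<le> b" "b < a"
  shows "\<forall>\<^sub>F \<tau> in at_right 0. \<forall>x. og_reject a L \<tau> x \<longrightarrow> x\<^sup>2 > 4 * b * ln (1 / \<tau>)"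
proof -
  \<comment> \<open>The gap between \<open>b\<close> and \<open>b1\<close> leaves a spare factor
    \<open>\<tau> powr (2 * (b1 - b))\<close>, which absorbs the constants \<open>c\<close> and
    \<open>D\<close>.\<close>
  obtain b1 where b1: "b < b1" "b1 < a" using b dense by blast
  obtain c where c: "c > 0" "\<forall>\<^sub>F \<tau> in at_right 0. \<forall>x. og_reject a L \<tau> x \<longrightarrow>
      exp (- x\<^sup>2 / 2) < c * tail a L (1 / \<tau>\<^sup>2)"
    using og_reject_tail[OF prior] by blast
  obtain D where D: "D > 0" "\<forall>\<^sub>F y in at_top. tail a L y \<le> D * y powr (-b1)"
    using tail_upper[OF prior, of b1] b b1 by auto
  have D': "\<forall>\<^sub>F \<tau> in at_right 0. tail a L (1 / \<tau>\<^sup>2) \<le> D * (1 / \<tau>\<^sup>2) powr (-b1)"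
    using eventually_compose_filterlim[OF D(2) filterlim_scale_inverse_square[of 1]] by simp
  have "((\<lambda>\<tau>. c * D * \<tau> powr (2 * (b1 - b))) \<longlongrightarrow> 0) (at_right 0)"
    using b1 by real_asymp
  then have small: "\<forall>\<^sub>F \<tau> in at_right 0. c * D * \<tau> powr (2 * (b1 - b)) < 1"
    by (rule order_tendstoD) simp
  show ?thesis
    using c(2) D' small eventually_at_right_less[of 0]
  proof eventually_elim
    case (elim \<tau>)
    show ?case
    proof (intro allI impI)
      fix x assume rej: "og_reject a L \<tau> x"
      have "exp (- x\<^sup>2 / 2) < c * tail a L (1 / \<tau>\<^sup>2)" using elim rej by blast
      also have "\<dots> \<le> c * (D * (1 / \<tau>\<^sup>2) powr (-b1))" using elim rej c(1) by (intro mult_left_mono) auto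
      also have "(1 / \<tau>\<^sup>2) powr (-b1) = \<tau> powr (2 * (b1 - b)) * \<tau> powr (2 * b)"
        using elim(4) by (simp add: inverse_square_powr powr_add[symmetric] algebra_simps)
      also have "c * (D * (\<tau> powr (2 * (b1 - b)) * \<tau> powr (2 * b))) =
          (c * D * \<tau> powr (2 * (b1 - b))) * \<tau> powr (2 * b)" by (simp only: mult.assoc)
      also have "\<dots> \<le> 1 * \<tau> powr (2 * b)" using elim(3) by (intro mult_right_mono) auto
      also have "\<dots> = exp (2 * b * ln \<tau>)" using elim(4) by (simp add: powr_def)
      finally have "- x\<^sup>2 / 2 < 2 * b * ln \<tau>" by simp
      then show "x\<^sup>2 > 4 * b * ln (1 / \<tau>)" using elim(4) by (simp add: ln_div)
    qed
  qed
qed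

text \<open>For \<open>t \<le> 1 / \<tau>\<^sup>2\<close> one has
  \<open>shrink \<tau> t \<ge> 1/2\<close>, so the negative part is at most
  \<open>exp (- x\<^sup>2 / 4)\<close> times the total mass. A dyadic block far beyond
  \<open>1 / \<tau>\<^sup>2\<close> has \<open>shrink\<close> at most a small \<open>\<rho>\<close>
  and contributes \<open>exp (- \<rho> * x\<^sup>2 / 2)\<close> times a mass of order at least
  \<open>\<tau> powr (2 * b)\<close> with \<open>b > a\<close>. The exponential gain wins once
  \<open>A / 4 > 2 * b\<close>, up to the loss from \<open>\<rho>\<close>.\<close>

lemma og_reject_of_large:
  assumes prior: "one_group_prior a K L" and A: "A > 8 * a"
  shows "\<forall>\<^sub>F \<tau> in at_right 0. \<forall>x. x\<^sup>2 \<ge> A * ln (1 / \<tau>) \<longrightarrow> og_reject a L \<tau> x"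
proof -
  have a: "a > 0" using prior by (auto simp: one_group_prior_def)
  obtain b where b: "a < b" "b < A / 8" using A dense[of a "A / 8"] by auto
  \<comment> \<open>This is the critical value of \<open>\<rho>\<close>, at which
    \<open>(1 / 4 - \<rho> / 2) * A\<close> equals \<open>2 * b\<close>.\<close>
  define z where "z = 1 / 2 - 4 * b / A"
  have z: "z > 0" using a b A by (simp add: z_def field_simps)
  \<comment> \<open>The block starts at \<open>u / \<tau>\<^sup>2\<close>, where
    \<open>shrink\<close> equals \<open>\<rho>\<close>. The bound \<open>1 / z\<close> makes
    \<open>\<rho> < z\<close>; the bound 3 makes \<open>\<rho> \<le> 1/4\<close> and hence
    \<open>1 - 2 * shrink \<tau> t \<ge> 1/2\<close> on the block.\<close>
  define u where "u = max 3 (1 / z)"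
  have u: "u \<ge> 3" "1 / z \<le> u" by (auto simp: u_def)
  define \<rho> where "\<rho> = 1 / (1 + u)"
  have \<rho>: "\<rho> > 0" "\<rho> \<le> 1 / 4" "\<rho> < z"
    using u z by (auto simp: \<rho>_def field_simps)
  define q where "q = (1 / 4 - \<rho> / 2) * A"
  have q: "q > 2 * b"
  proof -
    have "A > 0" using a A by simp
    then have "(1 / 4 - z / 2) * A < q" using \<rho> unfolding q_def by (intro mult_strict_right_mono) auto
    moreover have "(1 / 4 - z / 2) * A = 2 * b" using \<open>A > 0\<close> by (simp add: z_def field_simps)
    ultimately show ?thesis by simp
  qed
  \<comment> \<open>The square root is that of the smallest \<open>shrink\<close> on the block,
    taken at its right end; the half bounds \<open>1 - 2 * shrink \<tau> t\<close> from
    below.\<close>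
  define d where "d = sqrt (1 / (1 + 2 * u)) / 2"
  have d: "d > 0" using u by (simp add: d_def)
  define F where "F = (LINT t|lborel. mix a L t)"
  have F: "F > 0"
    unfolding F_def using mix_nonneg[OF prior] mix_pos[OF prior]
    by (intro integral_pos_of_pos_on[of _ 0 1] mix_integrable[OF prior]) auto
  obtain c where c: "c > 0" "\<forall>\<^sub>F y in at_top. tail a L y - tail a L (2 * y) \<ge> c * tail a L y"
    using tail_le_diff[OF prior] by blast
  obtain D where D: "D > 0" "\<forall>\<^sub>F y in at_top. tail a L y \<ge> D * y powr (-b)"
    using tail_lower[OF prior b(1)] by blast
  have lim: "filterlim (\<lambda>\<tau>::real. u * (1 / \<tau>\<^sup>2)) at_top (at_right 0)"
    using u by (intro filterlim_scale_inverse_square) simp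
  have diff: "\<forall>\<^sub>F \<tau> in at_right 0. tail a L (u * (1 / \<tau>\<^sup>2)) - tail a L (2 * (u * (1 / \<tau>\<^sup>2))) \<ge>
      c * (D * (u * (1 / \<tau>\<^sup>2)) powr (-b))"
    using eventually_compose_filterlim[OF c(2) lim] eventually_compose_filterlim[OF D(2) lim]
  proof eventually_elim
    case (elim \<tau>)
    have "c * (D * (u * (1 / \<tau>\<^sup>2)) powr (-b)) \<le> c * tail a L (u * (1 / \<tau>\<^sup>2))"
      using elim c(1) by (intro mult_left_mono) auto
    then show ?case using elim by linarith
  qed
  have "filterlim (\<lambda>\<tau>::real. (d * c * D * u powr (-b)) * \<tau> powr (2 * b - q)) at_top (at_right 0)"
  proof -
    have "filterlim (\<lambda>\<tau>::real. \<tau> powr (2 * b - q)) at_top (at_right 0)" using q by real_asymp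
    moreover have "d * c * D * u powr (-b) > 0" using d c(1) D(1) u by simp
    ultimately show ?thesis by (intro filterlim_tendsto_pos_mult_at_top[OF tendsto_const])
  qed
  then have large: "\<forall>\<^sub>F \<tau> in at_right 0. (d * c * D * u powr (-b)) * \<tau> powr (2 * b - q) > F"
    by (auto simp: filterlim_at_top_dense)
  show ?thesis
    using diff large eventually_at_right_less[of 0]
  proof eventually_elim
    case (elim \<tau>)
    show ?case
    proof (intro allI impI)
      fix x assume rej: "x\<^sup>2 \<ge> A * ln (1 / \<tau>)"
      define y where "y = 1 / \<tau>\<^sup>2"
      have \<tau>: "\<tau> > 0" by fact
      have y: "y > 0" using \<tau> by (simp add: y_def)
      have \<tau>y: "\<tau>\<^sup>2 = 1 / y" by (simp add: y_def)
      note int = odds_integrable[OF prior \<tau>, of x]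
      have pw: "mix a L t * lik \<tau> x t * (1 - 2 * shrink \<tau> t) \<ge>
          d * exp (- \<rho> * x\<^sup>2 / 2) * (indicator {u*y<..2*(u*y)} t * mix a L t) - exp (- x\<^sup>2 / 4) * mix a L t" for t
      proof (cases "t > 0")
        case True
        note s = shrink_bounds[OF True \<tau>] and l = lik_bounds[OF True \<tau>, of x] and m = mix_pos[OF prior True]
        have uy: "u * y \<ge> 3 * y" using u y by (intro mult_right_mono) auto
        consider "t \<in> {u*y<..2*(u*y)}" | "t > y" "t \<notin> {u*y<..2*(u*y)}" | "t \<le> y" by linarith
        then show ?thesis
        proof cases
          case 1
          have s1: "shrink \<tau> t \<le> \<rho>" "shrink \<tau> t \<ge> 1 / (1 + 2 * u)"
            using 1 y u True by (auto simp: shrink_def \<tau>y \<rho>_def field_simps)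
          have "exp (- shrink \<tau> t * x\<^sup>2 / 2) \<ge> exp (- \<rho> * x\<^sup>2 / 2)"
            using s1 mult_right_mono[of "shrink \<tau> t" \<rho> "x\<^sup>2"] by simp
          then have "lik \<tau> x t \<ge> 2 * d * exp (- \<rho> * x\<^sup>2 / 2)"
            using s s1 unfolding lik_def d_def by (intro mult_mono) auto
          then have "lik \<tau> x t * (1 - 2 * shrink \<tau> t) \<ge> 2 * d * exp (- \<rho> * x\<^sup>2 / 2) * (1 / 2)"
            using s1 \<rho> d l by (intro mult_mono) auto
          then have "mix a L t * (lik \<tau> x t * (1 - 2 * shrink \<tau> t)) \<ge> mix a L t * (d * exp (- \<rho> * x\<^sup>2 / 2))"
            using m by (intro mult_left_mono) auto
          moreover have "exp (- x\<^sup>2 / 4) * mix a L t > 0" using m by simp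
          moreover have "indicator {u*y<..2*(u*y)} t = (1::real)" using 1 by simp
          ultimately show ?thesis by (simp add: mult_ac)
        next
          case 2
          have "shrink \<tau> t \<le> 1 / 2" using 2 y True by (simp add: shrink_def \<tau>y field_simps)
          then have "mix a L t * lik \<tau> x t * (1 - 2 * shrink \<tau> t) \<ge> 0" using m l by auto
          moreover have "exp (- x\<^sup>2 / 4) * mix a L t > 0" using m by simp
          moreover have "indicator {u*y<..2*(u*y)} t = (0::real)" using 2 by simp
          ultimately show ?thesis by simp
        next
          case 3
          have s2: "shrink \<tau> t \<ge> 1 / 2" using 3 y True by (simp add: shrink_def \<tau>y field_simps)
          have "exp (- shrink \<tau> t * x\<^sup>2 / 2) \<le> exp (- x\<^sup>2 / 4)"
            using s2 mult_right_mono[of "1 / 2" "shrink \<tau> t" "x\<^sup>2"] by simp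
          then have "lik \<tau> x t \<le> 1 * exp (- x\<^sup>2 / 4)"
            using s unfolding lik_def by (intro mult_mono) auto
          then have "lik \<tau> x t * (2 * shrink \<tau> t - 1) \<le> exp (- x\<^sup>2 / 4) * 1"
            using s s2 l by (intro mult_mono) auto
          then have le: "mix a L t * (lik \<tau> x t * (2 * shrink \<tau> t - 1)) \<le> mix a L t * exp (- x\<^sup>2 / 4)"
            using m by (intro mult_left_mono) auto
          have "t \<le> u * y" using 3 uy y by linarith
          then have zero: "indicator {u*y<..2*(u*y)} t = (0::real)" by simp
          have "mix a L t * lik \<tau> x t * (1 - 2 * shrink \<tau> t) =
              - (mix a L t * (lik \<tau> x t * (2 * shrink \<tau> t - 1)))"
            by (simp add: algebra_simps)
          also have "\<dots> \<ge> - (mix a L t * exp (- x\<^sup>2 / 4))"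
            using le by (rule le_imp_neg_le)
          finally show ?thesis unfolding zero by (simp add: mult.commute)
        qed
      qed (simp add: mix_def)
      have "exp (- x\<^sup>2 / 4) * F < d * exp (- \<rho> * x\<^sup>2 / 2) * (tail a L (u * y) - tail a L (2 * (u * y)))"
      proof -
        \<comment> \<open>After multiplication by \<open>exp (x\<^sup>2 / 4)\<close> the claim
          compares \<open>F\<close> with the gain \<open>exp ((1 / 4 - \<rho> / 2) * x\<^sup>2)
          \<ge> \<tau> powr (-q)\<close> times the block mass. Since \<open>q > 2 * b\<close>, the
          product diverges.\<close>
        have "F < (d * c * D * u powr (-b)) * \<tau> powr (2 * b - q)" using elim rej by simp
        also have "\<dots> = d * \<tau> powr (-q) * (c * (D * (u * (1 / \<tau>\<^sup>2)) powr (-b)))"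
        proof -
          have "(u * (1 / \<tau>\<^sup>2)) powr (-b) = u powr (-b) * \<tau> powr (2 * b)"
            using inverse_square_powr[OF \<tau>, of "-b"] by (simp only: powr_mult) simp
          then show ?thesis by (simp add: powr_diff powr_minus divide_inverse)
        qed
        also have "\<dots> \<le> d * \<tau> powr (-q) * (tail a L (u * y) - tail a L (2 * (u * y)))"
          using elim rej d unfolding y_def by (intro mult_left_mono) auto
        also have "\<dots> \<le> d * exp ((1 / 4 - \<rho> / 2) * x\<^sup>2) * (tail a L (u * y) - tail a L (2 * (u * y)))"
        proof -
          have "\<tau> powr (-q) = exp ((1 / 4 - \<rho> / 2) * (A * ln (1 / \<tau>)))"
            using \<tau> by (simp add: powr_def q_def ln_div)
          also have "\<dots> \<le> exp ((1 / 4 - \<rho> / 2) * x\<^sup>2)"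
            using \<rho> rej by (subst exp_le_cancel_iff, intro mult_left_mono) auto
          finally show ?thesis
            using d tail_antimono[OF prior, of "u * y" "2 * (u * y)"] u y
            by (intro mult_right_mono mult_left_mono) auto
        qed
        finally have "exp (- x\<^sup>2 / 4) * F <
            exp (- x\<^sup>2 / 4) * (d * exp ((1 / 4 - \<rho> / 2) * x\<^sup>2) * (tail a L (u * y) - tail a L (2 * (u * y))))"
          by (rule mult_strict_left_mono) simp
        also have "\<dots> = d * (exp (- x\<^sup>2 / 4) * exp ((1 / 4 - \<rho> / 2) * x\<^sup>2)) * (tail a L (u * y) - tail a L (2 * (u * y)))"
          by (simp only: mult_ac)
        also have "exp (- x\<^sup>2 / 4) * exp ((1 / 4 - \<rho> / 2) * x\<^sup>2) = exp (- \<rho> * x\<^sup>2 / 2)"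
          by (simp add: exp_add[symmetric] algebra_simps)
        finally show ?thesis .
      qed
      also have "d * exp (- \<rho> * x\<^sup>2 / 2) * (tail a L (u * y) - tail a L (2 * (u * y))) =
         (LINT t|lborel. d * exp (- \<rho> * x\<^sup>2 / 2) * (indicator {u*y<..2*(u*y)} t * mix a L t) -
           exp (- x\<^sup>2 / 4) * mix a L t) + exp (- x\<^sup>2 / 4) * F"
      proof -
        have "integrable lborel (\<lambda>t. d * exp (- \<rho> * x\<^sup>2 / 2) * (indicator {u*y<..2*(u*y)} t * mix a L t))"
          "integrable lborel (\<lambda>t. exp (- x\<^sup>2 / 4) * mix a L t)"
          by (intro integrable_mult_right mix_indicator_integrable[OF prior] mix_integrable[OF prior]; simp)+
        then show ?thesis
          using u y by (simp add: tail_diff[OF prior] F_def)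
      qed
      also have "\<dots> \<le> (LINT t|lborel. mix a L t * lik \<tau> x t * (1 - 2 * shrink \<tau> t)) + exp (- x\<^sup>2 / 4) * F"
        by (intro add_right_mono integral_mono int pw Bochner_Integration.integrable_diff integrable_mult_right
            mix_indicator_integrable[OF prior] mix_integrable[OF prior]) auto
      finally show "og_reject a L \<tau> x" using og_reject_iff[OF prior \<tau>] by simp
    qed
  qed
qed

section \<open>Normal probabilities and error probabilities\<close>

lemma prob_space_std_normal: "prob_space std_normal_distribution"
  using prob_space_normal_density[of 1 0] by simp

lemma measure_std_normal:
  assumes [measurable]: "A \<in> sets borel"
  shows "measure std_normal_distribution A = (LINT z|lborel. std_normal_density z * indicator A z)"
proof -
  interpret prob_space std_normal_distribution by (rule prob_space_std_normal)
  have "measure std_normal_distribution A = integral\<^sup>L std_normal_distribution (indicator A)"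
    by simp
  also have "\<dots> = (LINT z|lborel. std_normal_density z *\<^sub>R indicator A z)"
    by (subst integral_density) auto
  finally show ?thesis by simp
qed

lemma measure_std_normal_uminus:
  assumes [measurable]: "A \<in> sets borel"
  shows "measure std_normal_distribution {z. - z \<in> A} = measure std_normal_distribution A"
proof -
  have "{z. - z \<in> A} = uminus -` A \<inter> space borel" by auto
  also have "\<dots> \<in> sets borel" by measurable
  finally have [measurable]: "{z. - z \<in> A} \<in> sets borel" .
  have "measure std_normal_distribution A = (LINT z|lborel. std_normal_density z * indicator A z)"
    by (rule measure_std_normal) fact
  also have "\<dots> = (LINT z|lborel. std_normal_density z * indicator {z. - z \<in> A} z)"
    by (subst lborel_integral_real_affine[of "-1" _ 0])
      (auto simp: normal_density_def indicator_def)
  also have "\<dots> = measure std_normal_distribution {z. - z \<in> A}"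
    by (rule measure_std_normal[symmetric]) fact
  finally show ?thesis by simp
qed

lemma measure_std_normal_singleton: "measure std_normal_distribution {x} = 0"
proof -
  have "AE z in lborel. std_normal_density z * indicator {x} z = 0"
    using AE_lborel_singleton[of x] by eventually_elim auto
  then show ?thesis
    by (subst measure_std_normal) (auto intro!: integral_eq_zero_AE)
qed

lemma isCont_std_normal_cdf: "isCont std_normal_cdf x"
proof -
  interpret real_distribution std_normal_distribution by (rule real_dist_normal_dist)
  show ?thesis
    unfolding std_normal_cdf_def isCont_cdf by (rule measure_std_normal_singleton)
qed

text \<open>Symmetry turns the left tail into the right one. The absence of atoms makes the choice
  between closed and half-open intervals immaterial.\<close>

lemma std_normal_central:
  assumes "s \<ge> 0"
  shows "measure std_normal_distribution {z. \<bar>z\<bar> \<le> s} = 2 * std_normal_cdf s - 1"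
proof -
  interpret real_distribution std_normal_distribution by (rule real_dist_normal_dist)
  have "{z. - z \<in> {..- s}} = {s..}" by auto
  then have sym: "std_normal_cdf (- s) = prob {s..}"
    using measure_std_normal_uminus[of "{..- s}"] by (simp add: std_normal_cdf_def cdf_def)
  have "{s..} = {s} \<union> {s<..}" by auto
  then have "prob {s..} = prob {s} + prob {s<..}"
    by (simp only:, intro finite_measure_Union) auto
  then have "prob {s..} = prob {s<..}" using measure_std_normal_singleton[of s] by simp
  also have "{s<..} = space std_normal_distribution - {..s}" by auto
  also have "prob \<dots> = 1 - prob {..s}" by (rule prob_compl) simp
  finally have compl: "prob {s..} = 1 - std_normal_cdf s" by (simp add: std_normal_cdf_def cdf_def)
  have "{z. \<bar>z\<bar> \<le> s} = {- s} \<union> {- s<..s}" using assms by auto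
  then have "prob {z. \<bar>z\<bar> \<le> s} = prob {- s} + prob {- s<..s}"
    by (simp only:, intro finite_measure_Union) auto
  also have "prob {- s} = 0" by (rule measure_std_normal_singleton)
  also have "prob {- s<..s} = std_normal_cdf s - std_normal_cdf (- s)"
  proof (cases "s = 0")
    case False
    then show ?thesis using assms by (simp add: std_normal_cdf_def cdf_diff_eq)
  qed simp
  finally show ?thesis using sym compl by simp
qed

lemma std_normal_central_pos:
  assumes "s > 0"
  shows "2 * std_normal_cdf s - 1 > 0"
proof -
  have [measurable]: "{z. \<bar>z\<bar> \<le> s} \<in> sets borel" by measurable
  have "0 < (LINT z|lborel. std_normal_density z * indicator {z. \<bar>z\<bar> \<le> s} z)"
    using assms integrable_mult_indicator[of "{z. \<bar>z\<bar> \<le> s}" lborel std_normal_density]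
    by (intro integral_pos_of_pos_on[of _ 0 s])
      (auto simp: mult.commute normal_density_pos)
  then show ?thesis
    using std_normal_central[of s] assms measure_std_normal[of "{z. \<bar>z\<bar> \<le> s}"] by simp
qed

text \<open>Mills' ratio: on \<open>[T,\<infinity>)\<close> the density is at most \<open>z / T\<close> times itself, which is an exact
  derivative.\<close>

lemma std_normal_tail_le:
  assumes T: "T > 0"
  shows "measure std_normal_distribution {z. T \<le> \<bar>z\<bar>} \<le> exp (- T\<^sup>2 / 2) / T"
proof -
  interpret real_distribution std_normal_distribution by (rule real_dist_normal_dist)
  have "emeasure std_normal_distribution {T..} =
      (\<integral>\<^sup>+z. ennreal (std_normal_density z) * indicator {T..} z \<partial>lborel)"
    by (subst emeasure_density) auto
  also have "\<dots> \<le> (\<integral>\<^sup>+z. ennreal (z * std_normal_density z / T) * indicator {T..} z \<partial>lborel)"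
    using T by (intro nn_integral_mono) (auto simp: indicator_def field_simps intro!: ennreal_leI mult_right_mono)
  also have "\<dots> = ennreal (0 - (- std_normal_density T / T))"
  proof (rule nn_integral_FTC_atLeast[where F = "\<lambda>z. - std_normal_density z / T"])
    show "(\<lambda>z. z * std_normal_density z / T) \<in> borel_measurable borel" by measurable
    show "((\<lambda>z. - std_normal_density z / T) has_real_derivative z * std_normal_density z / T) (at z)" for z
      unfolding normal_density_def using T
      by (auto intro!: derivative_eq_intros simp: field_simps power2_eq_square)
    show "0 \<le> z * std_normal_density z / T" if "T \<le> z" for z using that T by simp
    show "((\<lambda>z. - std_normal_density z / T) \<longlongrightarrow> 0) at_top"
      unfolding normal_density_def using T by real_asymp
  qed
  finally have "emeasure std_normal_distribution {T..} \<le> ennreal (std_normal_density T / T)" by simp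
  then have right: "prob {T..} \<le> std_normal_density T / T"
    using T by (simp add: emeasure_eq_measure)
  have "{z. - z \<in> {T..}} = {..- T}" by auto
  then have left: "prob {..- T} = prob {T..}" using measure_std_normal_uminus[of "{T..}"] by simp
  have "{z. T \<le> \<bar>z\<bar>} = {T..} \<union> {..- T}" using T by auto
  then have "prob {z. T \<le> \<bar>z\<bar>} \<le> prob {T..} + prob {..- T}"
    by (simp only:, intro measure_Un_le) auto
  also have "\<dots> \<le> 2 / sqrt (2 * pi) * exp (- T\<^sup>2 / 2) / T"
    using left right by (simp add: normal_density_def)
  \<comment> \<open>The normalising constant of the density absorbs the factor 2 from the two
    tails.\<close>
  also have "\<dots> \<le> 1 * exp (- T\<^sup>2 / 2) / T"
  proof -
    have "sqrt (2 * 2) \<le> sqrt (2 * pi)" using pi_ge_two by (intro real_sqrt_le_mono) simp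
    then have "2 / sqrt (2 * pi) \<le> 1" by simp
    then show ?thesis using T by (intro divide_right_mono mult_right_mono) auto
  qed
  finally show ?thesis by simp
qed

lemma measure_normal_scale:
  assumes [measurable]: "A \<in> sets borel" and \<sigma>: "\<sigma> > 0"
  shows "measure (density lborel (\<lambda>x. ennreal (normal_density 0 \<sigma> x))) A =
    measure std_normal_distribution {z. \<sigma> * z \<in> A}"
proof -
  have "{z. \<sigma> * z \<in> A} = (\<lambda>z. \<sigma> * z) -` A \<inter> space borel" by auto
  also have "\<dots> \<in> sets borel" by measurable
  finally have [measurable]: "{z. \<sigma> * z \<in> A} \<in> sets borel" .
  have "emeasure (density lborel (\<lambda>x. ennreal (normal_density 0 \<sigma> x))) A =
      (\<integral>\<^sup>+x. ennreal (normal_density 0 \<sigma> x) * indicator A x \<partial>lborel)"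
    by (subst emeasure_density) auto
  also have "\<dots> = \<sigma> * (\<integral>\<^sup>+z. ennreal (normal_density 0 \<sigma> (\<sigma> * z)) * indicator A (\<sigma> * z) \<partial>lborel)"
    using \<sigma> by (subst nn_integral_real_affine[of _ \<sigma> 0]) auto
  also have "\<dots> = (\<integral>\<^sup>+z. ennreal \<sigma> * (ennreal (normal_density 0 \<sigma> (\<sigma> * z)) * indicator A (\<sigma> * z)) \<partial>lborel)"
    by (rule nn_integral_cmult[symmetric]) measurable
  also have "\<dots> = (\<integral>\<^sup>+z. ennreal (std_normal_density z) * indicator {z. \<sigma> * z \<in> A} z \<partial>lborel)"
  proof (intro nn_integral_cong)
    fix z
    have "\<sigma> * normal_density 0 \<sigma> (\<sigma> * z) = std_normal_density z"
      using \<sigma> by (simp add: normal_density_def real_sqrt_mult power_mult_distrib)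
    then have "ennreal \<sigma> * ennreal (normal_density 0 \<sigma> (\<sigma> * z)) = ennreal (std_normal_density z)"
      using \<sigma> by (simp add: ennreal_mult[symmetric])
    then show "ennreal \<sigma> * (ennreal (normal_density 0 \<sigma> (\<sigma> * z)) * indicator A (\<sigma> * z)) =
        ennreal (std_normal_density z) * indicator {z. \<sigma> * z \<in> A} z"
      by (simp add: mult.assoc[symmetric] indicator_def)
  qed
  also have "\<dots> = emeasure std_normal_distribution {z. \<sigma> * z \<in> A}"
    by (subst emeasure_density) auto
  finally show ?thesis by (simp add: measure_def)
qed

section \<open>Error probabilities under the two-groups model\<close>

context two_groups_model
begin

lemma nu_X_measurable:
  assumes "i \<in> {1..m}"
  shows "Measurable.pred M (nu i)" "X i \<in> borel_measurable M"
proof -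
  have "(\<lambda>w. (nu i w, X i w)) \<in> measurable M (count_space UNIV \<Otimes>\<^sub>M borel)"
    using indep assms by (auto simp: indep_vars_def)
  then show "Measurable.pred M (nu i)" "X i \<in> borel_measurable M"
    using measurable_compose[OF _ measurable_fst, of "\<lambda>w. (nu i w, X i w)"]
      measurable_compose[OF _ measurable_snd, of "\<lambda>w. (nu i w, X i w)"] by auto
qed

text \<open>A conditional probability given \<open>Q\<close> is a probability under the uniform
  measure on that event, where \<open>X i\<close> has a normal density; rescaling by
  \<open>\<sigma>\<close> reduces it to the standard normal law. Taking \<open>nu i\<close> or its
  negation for \<open>Q\<close> covers both error types.\<close>

lemma cond_prob_distributed:
  assumes i: "i \<in> {1..m}" and R: "{x. R x} \<in> sets borel"
    and Q: "Measurable.pred M Q"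
    and dist: "distributed (uniform_measure M {w \<in> space M. Q w}) lborel (X i)
        (\<lambda>x. ennreal (normal_density 0 \<sigma> x))" and \<sigma>: "\<sigma> > 0"
  shows "\<P>(w in M. R (X i w) \<bar> Q w) = measure std_normal_distribution {z. R (\<sigma> * z)}"
proof -
  note [measurable] = nu_X_measurable[OF i] Q
  have R' [measurable]: "Measurable.pred borel R" using R by (simp add: pred_def)
  let ?U = "uniform_measure M {w \<in> space M. Q w}"
  have "\<P>(w in M. R (X i w) \<bar> Q w) = measure ?U {w \<in> space ?U. R (X i w)}"
    by (rule measure_uniform_measure_eq_cond_prob[symmetric]) measurable
  also have "\<dots> = measure (distr ?U lborel (X i)) {x. R x}"
    using R by (subst measure_distr) (auto intro!: arg_cong[where f="measure _"])
  also have "distr ?U lborel (X i) = density lborel (\<lambda>x. ennreal (normal_density 0 \<sigma> x))"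
    by (rule distributed_distr_eq_density[OF dist])
  also have "measure \<dots> {x. R x} = measure std_normal_distribution {z. \<sigma> * z \<in> {x. R x}}"
    by (rule measure_normal_scale[OF R \<sigma>])
  finally show ?thesis by simp
qed

text \<open>The conditional laws do not depend on the coordinate, so all \<open>m\<close> summands
  coincide.\<close>

lemma bayes_risk_eq:
  assumes R: "{x. R x} \<in> sets borel"
  shows "bayes_risk M m p nu (\<lambda>i w. R (X i w)) =
    real m * ((1 - p) * measure std_normal_distribution {z. R z} +
      p * measure std_normal_distribution {z. \<not> R (sqrt (1 + psi\<^sup>2) * z)})"
proof -
  have "{x. \<not> R x} = UNIV - {x. R x}" by auto
  then have R': "{x. \<not> R x} \<in> sets borel" using R by (metis sets.compl_sets space_borel)
  have pos: "sqrt (1 + psi\<^sup>2) > 0" by (simp add: add_pos_nonneg)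
  have "type1_error M (nu i) (\<lambda>w. R (X i w)) = measure std_normal_distribution {z. R z}"
    if i: "i \<in> {1..m}" for i
  proof -
    note [measurable] = nu_X_measurable[OF i]
    show ?thesis
      unfolding type1_error_def
      using cond_prob_distributed[OF i R _ X_law_null[OF i]] by simp
  qed
  moreover have "type2_error M (nu i) (\<lambda>w. R (X i w)) =
      measure std_normal_distribution {z. \<not> R (sqrt (1 + psi\<^sup>2) * z)}"
    if i: "i \<in> {1..m}" for i
    unfolding type2_error_def
    by (rule cond_prob_distributed[OF i R' nu_X_measurable(1)[OF i] X_law_alt[OF i] pos])
  ultimately show ?thesis
    by (simp add: bayes_risk_def)
qed

end

text \<open>The odds form exhibits the rejection region as a strict superlevel set of a parameter
  integral, which is measurable in its parameter.\<close>

lemma og_reject_measurable: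
  assumes prior: "one_group_prior a K L" and \<tau>: "\<tau> > 0"
  shows "{x. og_reject a L \<tau> x} \<in> sets borel"
proof -
  note [measurable] = mix_measurable[OF prior]
  have [measurable]: "(\<lambda>x. LINT t|lborel. mix a L t * lik \<tau> x t * (1 - 2 * shrink \<tau> t)) \<in> borel_measurable borel"
    unfolding lik_def by (intro lborel.borel_measurable_lebesgue_integral) measurable
  show ?thesis
    unfolding og_reject_iff[OF prior \<tau>] by measurable
qed

section \<open>Asymptotics of the Bayes risk\<close>

text \<open>The denominator is the scale needed for the type I error: \<open>\<tau>\<close> is
  comparable with \<open>p\<close>, and the square root comes from Mills' ratio at the threshold.
  For \<open>a > 1/2\<close> a power \<open>\<tau> powr (2 * b)\<close> with \<open>b > 1/2\<close>
  suffices; for \<open>a = 1/2\<close> the square root is exactly what the growth condition on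
  \<open>L\<close> can be set against.\<close>

lemma tail_small:
  assumes prior: "one_group_prior a K L"
    and cases: "1/2 < a \<or> (a = 1/2 \<and> ((\<lambda>t. L t / sqrt (ln t)) \<longlongrightarrow> 0) at_top)"
  shows "((\<lambda>\<tau>. tail a L (1 / \<tau>\<^sup>2) / (\<tau> * sqrt (2 * a * ln (1 / \<tau>)))) \<longlongrightarrow> 0) (at_right 0)"
    (is "(?f \<longlongrightarrow> 0) _")
proof -
  have a: "a > 0" using prior by (auto simp: one_group_prior_def)
  have lim: "filterlim (\<lambda>\<tau>::real. 1 / \<tau>\<^sup>2) at_top (at_right 0)"
    using filterlim_scale_inverse_square[of 1] by simp
  have "\<forall>\<^sub>F \<tau> in at_right 0. (1::real) > \<tau>"
    by (rule order_tendstoD(2)[OF tendsto_ident_at]) simp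
  then have range: "\<forall>\<^sub>F \<tau> in at_right 0. 0 < \<tau> \<and> \<tau> < (1::real)"
    using eventually_at_right_less[of 0] by eventually_elim simp
  have pos: "\<forall>\<^sub>F \<tau> in at_right 0. 0 \<le> ?f \<tau>"
    using range
  proof eventually_elim
    case (elim \<tau>)
    then show ?case using tail_pos[OF prior, of "1 / \<tau>\<^sup>2"] a by (auto simp: less_imp_le)
  qed
  from cases show ?thesis
  proof
    assume "1/2 < a"
    then obtain b where b: "1/2 < b" "b < a" using dense by blast
    obtain D where D: "D > 0" "\<forall>\<^sub>F y in at_top. tail a L y \<le> D * y powr (-b)"
      using tail_upper[OF prior, of b] b by auto
    have up: "\<forall>\<^sub>F \<tau> in at_right 0. ?f \<tau> \<le> D * \<tau> powr (2 * b) / (\<tau> * sqrt (2 * a * ln (1 / \<tau>)))"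
      using eventually_compose_filterlim[OF D(2) lim] range
    proof eventually_elim
      case (elim \<tau>)
      then have "tail a L (1 / \<tau>\<^sup>2) \<le> D * \<tau> powr (2 * b)"
        using inverse_square_powr[of \<tau> "-b"] by simp
      then show ?case using elim(2) a by (intro divide_right_mono) auto
    qed
    have "((\<lambda>\<tau>. D * \<tau> powr (2 * b) / (\<tau> * sqrt (2 * a * ln (1 / \<tau>)))) \<longlongrightarrow> 0) (at_right 0)"
      using b a by real_asymp
    then show ?thesis by (rule tendsto_sandwich[OF pos up tendsto_const])
  next
    assume *: "a = 1/2 \<and> ((\<lambda>t. L t / sqrt (ln t)) \<longlongrightarrow> 0) at_top"
    then have half: "a = 1/2" and L: "((\<lambda>t. L t / sqrt (ln t)) \<longlongrightarrow> 0) at_top" by auto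
    show ?thesis
    proof (rule tendstoI)
      fix e :: real assume e: "e > 0"
      show "\<forall>\<^sub>F \<tau> in at_right 0. dist (?f \<tau>) 0 < e"
        \<comment> \<open>Half of \<open>e\<close> is used because
          \<open>ln (1 / \<tau>\<^sup>2)\<close> is twice \<open>ln (1 / \<tau>)\<close>, which
          costs a factor \<open>sqrt 2 < 2\<close>.\<close>
        using eventually_compose_filterlim[OF tail_half[OF prior[unfolded half] L half_gt_zero[OF e]] lim] range pos
      proof eventually_elim
        case (elim \<tau>)
        define l where "l = ln (1 / \<tau>)"
        have l: "l > 0" using elim(2) by (simp add: l_def ln_div)
        have "ln (1 / \<tau>\<^sup>2) = 2 * l"
          using elim(2) by (simp add: l_def ln_div ln_realpow)
        moreover have "(1 / \<tau>\<^sup>2) powr (-1/2) = \<tau>"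
          using elim(2) inverse_square_powr[of \<tau> "-1/2"] by simp
        ultimately have "tail a L (1 / \<tau>\<^sup>2) \<le> e / 2 * \<tau> * sqrt (2 * l)"
          unfolding half using elim(1) e by simp
        also have "sqrt (2 * l) \<le> sqrt 2 * sqrt l" by (simp add: real_sqrt_mult)
        also have "e / 2 * \<tau> * (sqrt 2 * sqrt l) < e / 2 * \<tau> * (2 * sqrt l)"
          using l elim(2) e by (intro mult_strict_left_mono mult_strict_right_mono sqrt2_less_2) auto
        finally have "tail a L (1 / \<tau>\<^sup>2) < e * (\<tau> * sqrt l)"
          using e elim(2) by (simp add: mult.assoc)
        then have "?f \<tau> < e"
          unfolding half using l elim(2) by (simp add: l_def[symmetric] pos_divide_less_eq)
        then show ?case using elim(3) by (simp add: dist_real_def)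
      qed
    qed
  qed
qed

text \<open>Two necessary conditions for rejection are combined: the tail bound controls the
  exponential in Mills' ratio, and the crude threshold of order \<open>ln (1 / \<tau>)\<close>
  supplies its denominator.\<close>

lemma type1_small:
  assumes prior: "one_group_prior a K L"
    and cases: "1/2 < a \<or> (a = 1/2 \<and> ((\<lambda>t. L t / sqrt (ln t)) \<longlongrightarrow> 0) at_top)"
  shows "((\<lambda>\<tau>. measure std_normal_distribution {z. og_reject a L \<tau> z} / \<tau>) \<longlongrightarrow> 0) (at_right 0)"
    (is "(?t \<longlongrightarrow> 0) _")
proof -
  interpret real_distribution std_normal_distribution by (rule real_dist_normal_dist)
  have a: "a > 0" using prior by (auto simp: one_group_prior_def)
  obtain c where c: "c > 0" "\<forall>\<^sub>F \<tau> in at_right 0. \<forall>x. og_reject a L \<tau> x \<longrightarrow>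
      exp (- x\<^sup>2 / 2) < c * tail a L (1 / \<tau>\<^sup>2)"
    using og_reject_tail[OF prior] by blast
  have low: "\<forall>\<^sub>F \<tau> in at_right 0. \<forall>x. og_reject a L \<tau> x \<longrightarrow> x\<^sup>2 > 4 * (a / 2) * ln (1 / \<tau>)"
    using og_reject_lower[OF prior, of "a / 2"] a by simp
  have lt1: "\<forall>\<^sub>F \<tau> in at_right 0. (1::real) > \<tau>"
    by (rule order_tendstoD(2)[OF tendsto_ident_at]) simp
  have up: "\<forall>\<^sub>F \<tau> in at_right 0. ?t \<tau> \<le> c * (tail a L (1 / \<tau>\<^sup>2) / (\<tau> * sqrt (2 * a * ln (1 / \<tau>))))"
    using c(2) low lt1 eventually_at_right_less[of 0]
  proof eventually_elim
    case (elim \<tau>)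
    define B where "B = 2 * a * ln (1 / \<tau>)"
    define g where "g = c * tail a L (1 / \<tau>\<^sup>2)"
    \<comment> \<open>Both conditions on \<open>z\<^sup>2\<close> hold at once: the second entry
      gives \<open>exp (- T\<^sup>2 / 2) \<le> g\<close>, the first gives
      \<open>T \<ge> sqrt B\<close>.\<close>
    define T where "T = sqrt (max B (- 2 * ln g))"
    have B: "B > 0" using elim(3,4) a by (simp add: B_def)
    have g: "g > 0" using c(1) tail_pos[OF prior, of "1 / \<tau>\<^sup>2"] elim(4) by (simp add: g_def)
    have T: "T \<ge> sqrt B" "T\<^sup>2 = max B (- 2 * ln g)"
      using B by (auto simp: T_def)
    have Tpos: "T > 0" using T(1) B real_sqrt_gt_zero[OF B] by linarith
    have "{z. og_reject a L \<tau> z} \<subseteq> {z. T \<le> \<bar>z\<bar>}"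
    proof safe
      fix z assume rej: "og_reject a L \<tau> z"
      have "exp (- z\<^sup>2 / 2) < g" using elim(1) rej by (auto simp: g_def)
      then have "ln (exp (- z\<^sup>2 / 2)) < ln g" using g by (subst ln_less_cancel_iff) auto
      then have "z\<^sup>2 \<ge> - 2 * ln g" by simp
      moreover have "z\<^sup>2 \<ge> B" using elim(2) rej by (auto simp: B_def less_imp_le)
      ultimately have "max B (- 2 * ln g) \<le> z\<^sup>2" by simp
      then have "T \<le> sqrt (z\<^sup>2)" unfolding T_def by (rule real_sqrt_le_mono)
      then show "T \<le> \<bar>z\<bar>" by simp
    qed
    then have "prob {z. og_reject a L \<tau> z} \<le> prob {z. T \<le> \<bar>z\<bar>}"
      by (intro finite_measure_mono) auto
    also have "\<dots> \<le> exp (- T\<^sup>2 / 2) / T" by (rule std_normal_tail_le[OF Tpos])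
    also have "\<dots> \<le> g / sqrt B"
    proof (intro frac_le)
      have "exp (- T\<^sup>2 / 2) \<le> exp (ln g)" unfolding T(2) by (subst exp_le_cancel_iff) simp
      then show "exp (- T\<^sup>2 / 2) \<le> g" using g by simp
    qed (use g B T in auto)
    finally have "prob {z. og_reject a L \<tau> z} / \<tau> \<le> g / sqrt B / \<tau>"
      using elim(4) by (intro divide_right_mono) auto
    then show ?case by (simp add: g_def B_def mult.commute)
  qed
  have lower: "\<forall>\<^sub>F \<tau> in at_right 0. 0 \<le> ?t \<tau>"
    using eventually_at_right_less[of 0] by eventually_elim auto
  have "((\<lambda>\<tau>. c * (tail a L (1 / \<tau>\<^sup>2) / (\<tau> * sqrt (2 * a * ln (1 / \<tau>))))) \<longlongrightarrow> c * 0) (at_right 0)"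
    by (intro tendsto_intros tail_small[OF prior cases])
  then show ?thesis using tendsto_sandwich[OF lower up tendsto_const] by simp
qed

text \<open>Half of \<open>ln v - ln (\<psi>\<^sup>2)\<close> is \<open>ln (1 - p) - ln p\<close>;
  subtracting \<open>ln (1 - p) + ln (\<tau> / p)\<close> leaves \<open>ln (1 / \<tau>)\<close>.
  After division by \<open>\<psi>\<^sup>2\<close> only \<open>ln v\<close> survives in the limit,
  and replacing \<open>\<psi>\<^sup>2\<close> by \<open>1 + \<psi>\<^sup>2\<close> costs a factor
  tending to 1.\<close>

lemma log_signal_limit:
  fixes p psi tau :: "nat \<Rightarrow> real"
  assumes p_range: "\<And>m. m \<ge> 1 \<Longrightarrow> 0 < p m \<and> p m < 1"
    and psi_pos: "\<And>m. m \<ge> 1 \<Longrightarrow> (psi m)\<^sup>2 > 0"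
    and p_lim: "p \<longlonglongrightarrow> 0"
    and psi_lim: "filterlim (\<lambda>m. (psi m)\<^sup>2) at_top sequentially"
    and C_lim: "(\<lambda>m. ln ((psi m)\<^sup>2 * ((1 - p m) / p m)\<^sup>2) / (psi m)\<^sup>2) \<longlonglongrightarrow> C"
    and tau_pos: "\<And>m. m \<ge> 1 \<Longrightarrow> tau m > 0"
    and c_pos: "c > 0"
    and tau_p_lim: "(\<lambda>m. tau m / p m) \<longlonglongrightarrow> c"
  shows "(\<lambda>m. ln (1 / tau m) / (1 + (psi m)\<^sup>2)) \<longlonglongrightarrow> C / 2"
proof -
  have "((\<lambda>x::real. ln x / x) \<longlongrightarrow> 0) at_top" by real_asymp
  then have l1: "(\<lambda>m. ln ((psi m)\<^sup>2) / (psi m)\<^sup>2) \<longlonglongrightarrow> 0"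
    by (rule filterlim_compose[OF _ psi_lim])
  have inv: "(\<lambda>m. inverse ((psi m)\<^sup>2)) \<longlonglongrightarrow> 0"
    by (rule filterlim_compose[OF tendsto_inverse_0_at_top[OF filterlim_ident] psi_lim])
  have "(\<lambda>m. (ln (1 - p m) + ln (tau m / p m)) * inverse ((psi m)\<^sup>2)) \<longlonglongrightarrow> (ln (1 - 0) + ln c) * 0"
    using c_pos by (intro tendsto_intros p_lim tau_p_lim inv) auto
  then have "(\<lambda>m. (ln ((psi m)\<^sup>2 * ((1 - p m) / p m)\<^sup>2) / (psi m)\<^sup>2 - ln ((psi m)\<^sup>2) / (psi m)\<^sup>2) / 2
      - (ln (1 - p m) + ln (tau m / p m)) * inverse ((psi m)\<^sup>2)) \<longlonglongrightarrow> (C - 0) / 2 - 0"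
    by (intro tendsto_intros C_lim l1) simp_all
  moreover have "((\<lambda>x::real. x / (1 + x)) \<longlongrightarrow> 1) at_top" by real_asymp
  then have "(\<lambda>m. (psi m)\<^sup>2 / (1 + (psi m)\<^sup>2)) \<longlonglongrightarrow> 1"
    by (rule filterlim_compose[OF _ psi_lim])
  ultimately have lim: "(\<lambda>m. ((ln ((psi m)\<^sup>2 * ((1 - p m) / p m)\<^sup>2) / (psi m)\<^sup>2 - ln ((psi m)\<^sup>2) / (psi m)\<^sup>2) / 2
      - (ln (1 - p m) + ln (tau m / p m)) * inverse ((psi m)\<^sup>2)) *
      ((psi m)\<^sup>2 / (1 + (psi m)\<^sup>2))) \<longlonglongrightarrow> ((C - 0) / 2 - 0) * 1"
    by (rule tendsto_mult)
  have eq: "\<forall>\<^sub>F m in sequentially. ((ln ((psi m)\<^sup>2 * ((1 - p m) / p m)\<^sup>2) / (psi m)\<^sup>2 - ln ((psi m)\<^sup>2) / (psi m)\<^sup>2) / 2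
      - (ln (1 - p m) + ln (tau m / p m)) * inverse ((psi m)\<^sup>2)) *
      ((psi m)\<^sup>2 / (1 + (psi m)\<^sup>2)) = ln (1 / tau m) / (1 + (psi m)\<^sup>2)"
    using eventually_ge_at_top[of 1]
  proof eventually_elim
    case (elim m)
    note m = p_range[OF elim] psi_pos[OF elim] tau_pos[OF elim]
    define s where "s = (psi m)\<^sup>2"
    have s: "s > 0" using m by (simp add: s_def)
    have "ln (s * ((1 - p m) / p m)\<^sup>2) = ln s + 2 * (ln (1 - p m) - ln (p m))"
      using m s by (simp add: ln_mult ln_div ln_realpow)
    moreover have "ln (tau m / p m) = ln (tau m) - ln (p m)" "ln (1 / tau m) = - ln (tau m)"
      using m by (simp_all add: ln_div)
    ultimately show ?case
      unfolding s_def[symmetric] using s by (simp add: divide_simps)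
  qed
  from Lim_transform_eventually[OF lim eq] show ?thesis by simp
qed

section \<open>Limits of the type II error\<close>

lemma normal_scaled_central:
  assumes "\<sigma> > 0" "B \<ge> 0"
  shows "measure std_normal_distribution {z. (\<sigma> * z)\<^sup>2 \<le> B} = 2 * std_normal_cdf (sqrt (B / \<sigma>\<^sup>2)) - 1"
proof -
  have "(\<sigma> * z)\<^sup>2 \<le> B \<longleftrightarrow> \<bar>z\<bar> \<le> sqrt (B / \<sigma>\<^sup>2)" for z
  proof -
    have "(\<sigma> * z)\<^sup>2 \<le> B \<longleftrightarrow> \<bar>z\<bar>\<^sup>2 \<le> B / \<sigma>\<^sup>2"
      using assms by (simp add: power_mult_distrib field_simps)
    also have "\<dots> \<longleftrightarrow> \<bar>z\<bar> \<le> sqrt (B / \<sigma>\<^sup>2)"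
      using real_sqrt_le_iff[of "\<bar>z\<bar>\<^sup>2" "B / \<sigma>\<^sup>2"] by simp
    finally show ?thesis .
  qed
  then show ?thesis using std_normal_central[of "sqrt (B / \<sigma>\<^sup>2)"] assms by simp
qed

lemma scaled_central_limit:
  fixes l \<sigma> :: "nat \<Rightarrow> real"
  assumes lim: "(\<lambda>m. l m / (\<sigma> m)\<^sup>2) \<longlonglongrightarrow> C / 2"
  shows "(\<lambda>m. 2 * std_normal_cdf (sqrt (k * l m / (\<sigma> m)\<^sup>2)) - 1) \<longlonglongrightarrow>
    2 * std_normal_cdf (sqrt (k * C / 2)) - 1"
proof -
  have "(\<lambda>m. sqrt (k * (l m / (\<sigma> m)\<^sup>2))) \<longlonglongrightarrow> sqrt (k * (C / 2))"
    by (intro tendsto_intros lim)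
  then have "(\<lambda>m. 2 * std_normal_cdf (sqrt (k * (l m / (\<sigma> m)\<^sup>2))) - 1) \<longlonglongrightarrow>
      2 * std_normal_cdf (sqrt (k * (C / 2))) - 1"
    by (rule tendsto_diff[OF tendsto_mult[OF tendsto_const
          isCont_tendsto_compose[OF isCont_std_normal_cdf]] tendsto_const])
  then show ?thesis by simp
qed

text \<open>For \<open>b < a\<close> non-rejection eventually contains the central interval of
  squared radius \<open>4 * b * ln (1 / \<tau>)\<close>, whose probability tends to
  \<open>2 * std_normal_cdf (sqrt (2 * b * C)) - 1\<close>. Continuity in \<open>b\<close> at
  \<open>a\<close> from the left leaves a \<open>b\<close> for which this limit still exceeds
  \<open>e\<close>.\<close>

lemma type2_lower:
  fixes tau \<sigma> :: "nat \<Rightarrow> real"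
  assumes prior: "one_group_prior a K L"
    and tau: "filterlim tau (at_right 0) sequentially"
    and \<sigma>: "\<And>m. \<sigma> m > 0"
    and lim: "(\<lambda>m. ln (1 / tau m) / (\<sigma> m)\<^sup>2) \<longlonglongrightarrow> C / 2"
    and e: "e < 2 * std_normal_cdf (sqrt (2 * a * C)) - 1"
  shows "\<forall>\<^sub>F m in sequentially. e < measure std_normal_distribution {z. \<not> og_reject a L (tau m) (\<sigma> m * z)}"
proof -
  interpret real_distribution std_normal_distribution by (rule real_dist_normal_dist)
  have a: "a > 0" using prior by (auto simp: one_group_prior_def)
  have "((\<lambda>b. 2 * std_normal_cdf (sqrt (2 * b * C)) - 1) \<longlongrightarrow> 2 * std_normal_cdf (sqrt (2 * a * C)) - 1) (at_left a)"
    by (intro tendsto_intros isCont_tendsto_compose[OF isCont_std_normal_cdf])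
  then have "\<forall>\<^sub>F b in at_left a. e < 2 * std_normal_cdf (sqrt (2 * b * C)) - 1"
    using e by (rule order_tendstoD)
  moreover have "\<forall>\<^sub>F b in at_left a. b < a \<and> b > 0"
    using eventually_at_left_field[of "\<lambda>b. b < a \<and> b > 0" a] a by auto
  ultimately have "\<forall>\<^sub>F b in at_left a. e < 2 * std_normal_cdf (sqrt (2 * b * C)) - 1 \<and> b < a \<and> b > 0"
    by eventually_elim simp
  then obtain b where b: "e < 2 * std_normal_cdf (sqrt (2 * b * C)) - 1" "b < a" "b > 0"
    using eventually_happens[of _ "at_left a"] trivial_limit_at_left_real[of a] by auto
  have "(\<lambda>m. 2 * std_normal_cdf (sqrt (4 * b * ln (1 / tau m) / (\<sigma> m)\<^sup>2)) - 1) \<longlonglongrightarrow>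
      2 * std_normal_cdf (sqrt (4 * b * C / 2)) - 1"
    (is "_ \<longlonglongrightarrow> 2 * std_normal_cdf (sqrt ?x) - 1")
    by (rule scaled_central_limit[OF lim])
  then have "\<forall>\<^sub>F m in sequentially. e < 2 * std_normal_cdf (sqrt (4 * b * ln (1 / tau m) / (\<sigma> m)\<^sup>2)) - 1"
  proof (rule order_tendstoD)
    have "?x = 2 * b * C" by simp
    then show "e < 2 * std_normal_cdf (sqrt ?x) - 1" using b(1) by (simp only:)
  qed
  moreover have "\<forall>\<^sub>F m in sequentially. \<forall>x. og_reject a L (tau m) x \<longrightarrow> x\<^sup>2 > 4 * b * ln (1 / tau m)"
    using b by (intro eventually_compose_filterlim[OF og_reject_lower[OF prior] tau]) auto
  moreover have "\<forall>\<^sub>F m in sequentially. tau m > 0"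
    by (rule eventually_compose_filterlim[OF eventually_at_right_less tau])
  moreover have "\<forall>\<^sub>F m in sequentially. tau m < 1"
    by (rule eventually_compose_filterlim[OF order_tendstoD(2)[OF tendsto_ident_at] tau]) simp
  ultimately show ?thesis
  proof eventually_elim
    case (elim m)
    define B where "B = 4 * b * ln (1 / tau m)"
    have B: "B \<ge> 0" using elim(3,4) b by (simp add: B_def)
    have "{x. \<not> og_reject a L (tau m) x} = UNIV - {x. og_reject a L (tau m) x}" by auto
    then have [measurable]: "{x. \<not> og_reject a L (tau m) x} \<in> sets borel"
      using og_reject_measurable[OF prior elim(3)] by (metis sets.compl_sets space_borel)
    have "{z. \<not> og_reject a L (tau m) (\<sigma> m * z)} =
        (\<lambda>z. \<sigma> m * z) -` {x. \<not> og_reject a L (tau m) x} \<inter> space borel" by auto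
    also have "\<dots> \<in> sets borel" by measurable
    finally have "{z. \<not> og_reject a L (tau m) (\<sigma> m * z)} \<in> sets borel" .
    moreover have "{z. (\<sigma> m * z)\<^sup>2 \<le> B} \<subseteq> {z. \<not> og_reject a L (tau m) (\<sigma> m * z)}"
      using elim(2) by (force simp: B_def)
    ultimately have "prob {z. (\<sigma> m * z)\<^sup>2 \<le> B} \<le> prob {z. \<not> og_reject a L (tau m) (\<sigma> m * z)}"
      by (intro finite_measure_mono) auto
    then show ?case
      using elim(1) normal_scaled_central[OF \<sigma> B, of m] unfolding B_def by linarith
  qed
qed

text \<open>Non-rejection eventually lies in the central interval of squared radius
  \<open>A * ln (1 / \<tau>)\<close>. The constant \<open>A\<close> is kept fixed here, being
  strictly above \<open>8 * a\<close>.\<close>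

lemma type2_upper:
  fixes tau \<sigma> :: "nat \<Rightarrow> real"
  assumes prior: "one_group_prior a K L"
    and tau: "filterlim tau (at_right 0) sequentially"
    and \<sigma>: "\<And>m. \<sigma> m > 0"
    and lim: "(\<lambda>m. ln (1 / tau m) / (\<sigma> m)\<^sup>2) \<longlonglongrightarrow> C / 2"
    and A: "A > 8 * a"
    and e: "2 * std_normal_cdf (sqrt (A * C / 2)) - 1 < e"
  shows "\<forall>\<^sub>F m in sequentially. measure std_normal_distribution {z. \<not> og_reject a L (tau m) (\<sigma> m * z)} < e"
proof -
  interpret real_distribution std_normal_distribution by (rule real_dist_normal_dist)
  have a: "a > 0" using prior by (auto simp: one_group_prior_def)
  have "(\<lambda>m. 2 * std_normal_cdf (sqrt (A * ln (1 / tau m) / (\<sigma> m)\<^sup>2)) - 1) \<longlonglongrightarrow>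
      2 * std_normal_cdf (sqrt (A * C / 2)) - 1"
    by (rule scaled_central_limit[OF lim])
  then have "\<forall>\<^sub>F m in sequentially. 2 * std_normal_cdf (sqrt (A * ln (1 / tau m) / (\<sigma> m)\<^sup>2)) - 1 < e"
    using e by (rule order_tendstoD)
  moreover have "\<forall>\<^sub>F m in sequentially. \<forall>x. x\<^sup>2 \<ge> A * ln (1 / tau m) \<longrightarrow> og_reject a L (tau m) x"
    by (rule eventually_compose_filterlim[OF og_reject_of_large[OF prior A] tau])
  moreover have "\<forall>\<^sub>F m in sequentially. tau m > 0"
    by (rule eventually_compose_filterlim[OF eventually_at_right_less tau])
  moreover have "\<forall>\<^sub>F m in sequentially. tau m < 1"
    by (rule eventually_compose_filterlim[OF order_tendstoD(2)[OF tendsto_ident_at] tau]) simp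
  ultimately show ?thesis
  proof eventually_elim
    case (elim m)
    define B where "B = A * ln (1 / tau m)"
    have B: "B \<ge> 0" using elim(3,4) a A by (simp add: B_def ln_div mult_nonneg_nonpos)
    have "{z. \<not> og_reject a L (tau m) (\<sigma> m * z)} \<subseteq> {z. (\<sigma> m * z)\<^sup>2 \<le> B}"
      using elim(2) by (force simp: B_def)
    then have "prob {z. \<not> og_reject a L (tau m) (\<sigma> m * z)} \<le> prob {z. (\<sigma> m * z)\<^sup>2 \<le> B}"
      by (intro finite_measure_mono) auto
    then show ?case
      using elim(1) normal_scaled_central[OF \<sigma> B, of m] unfolding B_def by linarith
  qed
qed

section \<open>Relative error factors and the final bounds\<close>

lemma asymptotic_lower_bound_factor:
  fixes r :: "nat \<Rightarrow> real"
  assumes \<beta>: "\<beta> > 0" and low: "\<And>e. e < \<beta> \<Longrightarrow> \<forall>\<^sub>F m in sequentially. e < r m"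
  shows "\<exists>e1. e1 \<longlonglongrightarrow> 0 \<and> (\<forall>m. \<beta> * (1 + e1 m) \<le> r m)"
proof (intro exI conjI allI)
  \<comment> \<open>The relative deviation truncated at 0 makes the bound hold for every
    \<open>m\<close>; only its negative part has to vanish, which a lower bound on \<open>r\<close>
    ensures.\<close>
  let ?e = "\<lambda>m. min 0 (r m / \<beta> - 1)"
  show "?e \<longlonglongrightarrow> 0"
  proof (rule tendstoI)
    fix d :: real assume d: "d > 0"
    have "\<forall>\<^sub>F m in sequentially. \<beta> * (1 - d) < r m"
      using \<beta> d by (intro low) (simp add: algebra_simps)
    then show "\<forall>\<^sub>F m in sequentially. dist (?e m) 0 < d"
    proof eventually_elim
      case (elim m)
      then have "1 - d < r m / \<beta>" using \<beta> by (simp add: field_simps)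
      then show ?case using d by (auto simp: dist_real_def min_def)
    qed
  qed
  show "\<beta> * (1 + ?e m) \<le> r m" for m
  proof -
    have "\<beta> * (1 + ?e m) \<le> \<beta> * (r m / \<beta>)" using \<beta> by (intro mult_left_mono) auto
    then show ?thesis using \<beta> by simp
  qed
qed

lemma asymptotic_upper_bound_factor:
  fixes r :: "nat \<Rightarrow> real"
  assumes \<beta>: "\<beta> > 0" and up: "\<And>e. e > \<beta> \<Longrightarrow> \<forall>\<^sub>F m in sequentially. r m < e"
  shows "\<exists>e2. e2 \<longlonglongrightarrow> 0 \<and> (\<forall>m. r m \<le> \<beta> * (1 + e2 m))"
proof (intro exI conjI allI)
  \<comment> \<open>Here the truncation keeps the positive part of the relative deviation.\<close>
  let ?e = "\<lambda>m. max 0 (r m / \<beta> - 1)"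
  show "?e \<longlonglongrightarrow> 0"
  proof (rule tendstoI)
    fix d :: real assume d: "d > 0"
    have "\<forall>\<^sub>F m in sequentially. r m < \<beta> * (1 + d)"
      using \<beta> d by (intro up) (simp add: algebra_simps)
    then show "\<forall>\<^sub>F m in sequentially. dist (?e m) 0 < d"
    proof eventually_elim
      case (elim m)
      then have "r m / \<beta> < 1 + d" using \<beta> by (simp add: field_simps)
      then show ?case using d by (auto simp: dist_real_def max_def)
    qed
  qed
  show "r m \<le> \<beta> * (1 + ?e m)" for m
  proof -
    have "\<beta> * (r m / \<beta>) \<le> \<beta> * (1 + ?e m)" using \<beta> by (intro mult_left_mono) auto
    then show ?thesis using \<beta> by simp
  qed
qed

theorem theorem3p1:
  fixes M :: "nat \<Rightarrow> 'w measure"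
    and nu :: "nat \<Rightarrow> nat \<Rightarrow> 'w \<Rightarrow> bool"
    and X :: "nat \<Rightarrow> nat \<Rightarrow> 'w \<Rightarrow> real"
    and p psi tau v :: "nat \<Rightarrow> real"
    and L :: "real \<Rightarrow> real"
    and a K C c \<eta> \<delta> :: real
  defines "v \<equiv> \<lambda>m. (psi m)\<^sup>2 * ((1 - p m) / p m)\<^sup>2"
  assumes model: "\<And>m. m \<ge> 1 \<Longrightarrow> two_groups_model (M m) m (p m) (psi m) (nu m) (X m)"
    and p_range: "\<And>m. m \<ge> 1 \<Longrightarrow> 0 < p m \<and> p m < 1"
    and psi_pos: "\<And>m. m \<ge> 1 \<Longrightarrow> (psi m)\<^sup>2 > 0"
    and p_lim: "p \<longlonglongrightarrow> 0"
    and psi_lim: "filterlim (\<lambda>m. (psi m)\<^sup>2) at_top sequentially"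
    and v_lim: "filterlim v at_top sequentially"
    and C_pos: "C > 0"
    and C_lim: "(\<lambda>m. ln (v m) / (psi m)\<^sup>2) \<longlonglongrightarrow> C"
    and prior: "one_group_prior a K L"
    and tau_pos: "\<And>m. m \<ge> 1 \<Longrightarrow> tau m > 0"
    and tau_lim: "tau \<longlonglongrightarrow> 0"
    and c_pos: "c > 0"
    and tau_p_lim: "(\<lambda>m. tau m / p m) \<longlonglongrightarrow> c"
    and cases: "(1/2 < a \<and> a < 1) \<or> (a = 1/2 \<and> ((\<lambda>t. L t / sqrt (ln t)) \<longlongrightarrow> 0) at_top)"
    and eta: "0 < \<eta>" "\<eta> < 1/2"
    and delta: "0 < \<delta>" "\<delta> < 1"
  shows "\<exists>e1 e2 :: nat \<Rightarrow> real. e1 \<longlonglongrightarrow> 0 \<and> e2 \<longlonglongrightarrow> 0 \<and>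
    (\<forall>m\<ge>1.
      real m * p m * (2 * std_normal_cdf (sqrt (2 * a) * sqrt C) - 1) * (1 + e1 m)
        \<le> bayes_risk (M m) m (p m) (nu m) (\<lambda>i w. og_reject a L (tau m) (X m i w)) \<and>
      bayes_risk (M m) m (p m) (nu m) (\<lambda>i w. og_reject a L (tau m) (X m i w))
        \<le> real m * p m * (2 * std_normal_cdf (sqrt (2 * a * C / (\<eta> * (1 - \<delta>)))) - 1) * (1 + e2 m))"
proof -
  define \<sigma> where "\<sigma> m = sqrt (1 + (psi m)\<^sup>2)" for m
  have \<sigma>: "\<sigma> m > 0" and \<sigma>2: "(\<sigma> m)\<^sup>2 = 1 + (psi m)\<^sup>2" for m
    by (auto simp: \<sigma>_def add_pos_nonneg)
  define t1 where "t1 m = measure std_normal_distribution {z. og_reject a L (tau m) z}" for m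
  define t2 where "t2 m = measure std_normal_distribution {z. \<not> og_reject a L (tau m) (\<sigma> m * z)}" for m
  \<comment> \<open>This is the Bayes risk divided by \<open>m * p\<close>, so both bounds become
    statements about one real sequence.\<close>
  define r where "r m = (1 - p m) * (t1 m / p m) + t2 m" for m
  have a: "a > 0" using prior by (auto simp: one_group_prior_def)
  have risk: "bayes_risk (M m) m (p m) (nu m) (\<lambda>i w. og_reject a L (tau m) (X m i w)) =
      real m * p m * r m" if m: "m \<ge> 1" for m
  proof -
    interpret two_groups_model "M m" m "p m" "psi m" "nu m" "X m" by (rule model[OF m])
    show ?thesis
      unfolding bayes_risk_eq[OF og_reject_measurable[OF prior tau_pos[OF m]]]
      using p_range[OF m] by (simp add: r_def t1_def t2_def \<sigma>_def field_simps)
  qed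
  have tau0: "filterlim tau (at_right 0) sequentially"
  proof (rule tendsto_imp_filterlim_at_right[OF tau_lim])
    show "\<forall>\<^sub>F m in sequentially. tau m > 0"
      using eventually_ge_at_top[of 1] by eventually_elim (rule tau_pos)
  qed
  have ratio: "(\<lambda>m. ln (1 / tau m) / (\<sigma> m)\<^sup>2) \<longlonglongrightarrow> C / 2"
    unfolding \<sigma>2 using C_lim
    by (intro log_signal_limit[OF p_range psi_pos p_lim psi_lim _ tau_pos c_pos tau_p_lim]) (auto simp: v_def)
  have "((\<lambda>\<tau>. measure std_normal_distribution {z. og_reject a L \<tau> z} / \<tau>) \<longlongrightarrow> 0) (at_right 0)"
    using cases by (intro type1_small[OF prior]) auto
  then have "(\<lambda>m. t1 m / tau m) \<longlonglongrightarrow> 0"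
    unfolding t1_def by (rule filterlim_compose[OF _ tau0])
  \<comment> \<open>The finite limit of \<open>tau m / p m\<close> turns smallness relative to
    \<open>tau\<close> into smallness relative to \<open>p\<close>.\<close>
  then have "(\<lambda>m. (1 - p m) * (t1 m / tau m * (tau m / p m))) \<longlonglongrightarrow> (1 - 0) * (0 * c)"
    by (intro tendsto_intros p_lim tau_p_lim)
  moreover have "\<forall>\<^sub>F m in sequentially. (1 - p m) * (t1 m / tau m * (tau m / p m)) = (1 - p m) * (t1 m / p m)"
    using eventually_ge_at_top[of 1]
  proof eventually_elim
    case (elim m)
    then show ?case using tau_pos[OF elim] by simp
  qed
  ultimately have "(\<lambda>m. (1 - p m) * (t1 m / p m)) \<longlonglongrightarrow> (1 - 0) * (0 * c)"
    by (rule Lim_transform_eventually)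
  then have type1: "(\<lambda>m. (1 - p m) * (t1 m / p m)) \<longlonglongrightarrow> 0" by simp
  have "\<exists>e1. e1 \<longlonglongrightarrow> 0 \<and> (\<forall>m. (2 * std_normal_cdf (sqrt (2 * a) * sqrt C) - 1) * (1 + e1 m) \<le> r m)"
  proof (rule asymptotic_lower_bound_factor)
    show "0 < 2 * std_normal_cdf (sqrt (2 * a) * sqrt C) - 1"
      using a C_pos by (intro std_normal_central_pos) simp
  next
    fix e assume "e < 2 * std_normal_cdf (sqrt (2 * a) * sqrt C) - 1"
    then have "e < 2 * std_normal_cdf (sqrt (2 * a * C)) - 1" by (simp only: real_sqrt_mult)
    then have "\<forall>\<^sub>F m in sequentially. e < t2 m"
      unfolding t2_def by (rule type2_lower[OF prior tau0 \<sigma> ratio])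
    then show "\<forall>\<^sub>F m in sequentially. e < r m"
      using eventually_ge_at_top[of 1]
    proof eventually_elim
      case (elim m)
      \<comment> \<open>For the lower bound the type I contribution is simply discarded.\<close>
      have "(1 - p m) * (t1 m / p m) \<ge> 0" using p_range[OF elim(2)] by (auto simp: t1_def)
      then show ?case using elim(1) by (simp add: r_def)
    qed
  qed
  then obtain e1 where e1: "e1 \<longlonglongrightarrow> 0"
    "\<And>m. (2 * std_normal_cdf (sqrt (2 * a) * sqrt C) - 1) * (1 + e1 m) \<le> r m" by blast
  \<comment> \<open>Chosen so that \<open>A * C / 2\<close> is the argument under the square root in
    the upper bound; \<open>\<eta> * (1 - \<delta>) < 1/2\<close> then gives
    \<open>A > 8 * a\<close>.\<close>
  define A where "A = 4 * a / (\<eta> * (1 - \<delta>))"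
  have "\<eta> * (1 - \<delta>) < 1 / 2 * 1"
    using eta delta by (intro mult_strict_mono) auto
  moreover have "\<eta> * (1 - \<delta>) > 0" using eta delta by simp
  moreover have "8 * a * (\<eta> * (1 - \<delta>)) < 4 * a"
    using mult_strict_left_mono[of "\<eta> * (1 - \<delta>)" "1 / 2" "8 * a"] calculation(1) a by simp
  ultimately have A: "A > 8 * a" by (simp add: A_def pos_less_divide_eq)
  have AC: "A * C / 2 = 2 * a * C / (\<eta> * (1 - \<delta>))" by (simp add: A_def)
  have "\<exists>e2. e2 \<longlonglongrightarrow> 0 \<and> (\<forall>m. r m \<le> (2 * std_normal_cdf (sqrt (A * C / 2)) - 1) * (1 + e2 m))"
  proof (rule asymptotic_upper_bound_factor)
    show "0 < 2 * std_normal_cdf (sqrt (A * C / 2)) - 1"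
      using a A C_pos by (intro std_normal_central_pos) simp
  next
    fix e assume "2 * std_normal_cdf (sqrt (A * C / 2)) - 1 < e"
    \<comment> \<open>The margin up to \<open>e\<close> is split at \<open>d\<close>: the type II
      error stays below \<open>d\<close>, and the type I contribution below
      \<open>e - d\<close>.\<close>
    then obtain d where d: "2 * std_normal_cdf (sqrt (A * C / 2)) - 1 < d" "d < e" using dense by blast
    have "\<forall>\<^sub>F m in sequentially. t2 m < d"
      unfolding t2_def by (rule type2_upper[OF prior tau0 \<sigma> ratio A d(1)])
    moreover have "\<forall>\<^sub>F m in sequentially. (1 - p m) * (t1 m / p m) < e - d"
      using type1 by (rule order_tendstoD) (use d in simp)
    ultimately show "\<forall>\<^sub>F m in sequentially. r m < e"
      by eventually_elim (simp add: r_def)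
  qed
  then obtain e2 where e2: "e2 \<longlonglongrightarrow> 0"
    "\<And>m. r m \<le> (2 * std_normal_cdf (sqrt (2 * a * C / (\<eta> * (1 - \<delta>)))) - 1) * (1 + e2 m)"
    unfolding AC by blast
  show ?thesis
  proof (intro exI conjI allI impI)
    fix m :: nat assume m: "m \<ge> 1"
    have mp: "real m * p m \<ge> 0" using p_range[OF m] by simp
    show "real m * p m * (2 * std_normal_cdf (sqrt (2 * a) * sqrt C) - 1) * (1 + e1 m)
        \<le> bayes_risk (M m) m (p m) (nu m) (\<lambda>i w. og_reject a L (tau m) (X m i w))"
      unfolding risk[OF m] mult.assoc[of "real m * p m"] by (rule mult_left_mono[OF e1(2) mp])
    show "bayes_risk (M m) m (p m) (nu m) (\<lambda>i w. og_reject a L (tau m) (X m i w))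
        \<le> real m * p m * (2 * std_normal_cdf (sqrt (2 * a * C / (\<eta> * (1 - \<delta>)))) - 1) * (1 + e2 m)"
      unfolding risk[OF m] mult.assoc[of "real m * p m"] by (rule mult_left_mono[OF e2(2) mp])
  qed (fact e1(1) e2(1))+
qed

end
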